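(* Let $\Omega\subset\mathbb{R}^n$ be a star-like domain with center $0$, let $k\in\mathbb{N}$, $k\ge1$, and let $\alpha=\sum_{j=1}^n e_j\alpha_j\in\mathbb{R}^n$. If $\varphi\in\mathcal C^k(\Omega,\mathbb{R}_{0,n})$ is a solution to $(\mathcal D-\alpha)^k\varphi=0$ in $\Omega$, then there exist uniquely defined functions $\varphi_0,\dots,\varphi_{k-1}$ such that $$\varphi(\underline x)=\mathrm e^{\beta}\sum_{j=0}^{k-1}\underline x^{j}\varphi_j(\underline x),\qquad \underline x\in\Omega,$$ where $\beta=\sum_{j=1}^n\alpha_jx_j$, and each $\varphi_j$ is monogenic and given by $$\begin{cases}\varphi_0=(I-\underline x\mathcal Q_1\mathcal D)(I-\underline x^2\mathcal Q_2\mathcal D^2)\cdots(I-\underline x^{k-1}\mathcal Q_{k-1}\mathcal D^{k-1})(\mathrm e^{-\beta}\varphi),\\ \varphi_1=\mathcal Q_1\mathcal D(I-\underline x^2\mathcal Q_2\mathcal D^2)\cdots(I-\underline x^{k-1}\mathcal Q_{k-1}\mathcal D^{k-1})(\mathrm e^{-\beta}\varphi),\\ \quad\vdots\\ \varphi_{k-2}=\mathcal Q_{k-2}\mathcal D^{k-2}(I-\underline x^{k-1}\mathcal Q_{k-1}\mathcal D^{k-1})(\mathrm e^{-\beta}\varphi),\\ \varphi_{k-1}=\mathcal Q_{k-1}\mathcal D^{k-1}(\mathrm e^{-\beta}\varphi).\end{cases}$$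
   Context: $\mathbb{R}_{0,n}$ is the real Clifford algebra generated by the orthonormal basis $e_1,\dots,e_n$ of $\mathbb{R}^n$ with $e_j^2=-1$ and $e_ie_j+e_je_i=0$ for $i\neq j$; a point of $\mathbb{R}^n$ is identified with the vector $\underline x=\sum_{j=1}^n x_je_j$, and $\underline x^j$ is the Clifford power, acting by left multiplication. The Dirac operator is $\mathcal D=\sum_{j=1}^n e_j\partial_{x_j}$ acting from the left, and $\mathcal D-\alpha=\sum_{j=1}^n e_j(\partial_{x_j}-\alpha_j)$. A function $\psi\in\mathcal C^1(\Omega,\mathbb{R}_{0,n})$ is monogenic if $\mathcal D\psi=0$. $\Omega$ is star-like with center $0$ if $\underline x\in\Omega$ implies $t\underline x\in\Omega$ for all $0\le t\le1$. For $s>0$ and continuous $\psi$ on $\Omega$, $I_s\psi(\underline x)=\int_0^1\psi(t\underline x)t^{s-1}\,dt$. $I$ (without index) is the identity operator. For $k\ge1$, $$\mathcal Q_k=\frac1{a_k}I_{\frac n2}I_{\frac n2+1}\cdots I_{\frac n2+\left[\frac{k-1}{2}\right]},\qquad a_k=(-2)^k\left[\frac k2\right]!,$$ where the indices of the $I$'s increase in steps of $1$ and the bracket is defined by $[s]=m$ if $s=m$ is a nonnegative integer, and $[s]=m+1$ if $s=m+t$ with $m$ a nonnegative integer and $0<t<1$ (that is, non-integers are rounded up). For $k=1$ the formulas are read as $\varphi_0=\mathrm e^{-\beta}\varphi$.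
   Formalization: The bracket [s] in a_k and Q_k is taken as the integer part (rounding down) instead of rounding non-integers up; with rounding up the claim fails for k≥3 (e.g. α=0, φ=x² gives a φ_1 that is not monogenic), and for k=1,2 both readings agree. *)

theory Defs
  imports "HOL-Analysis.Analysis"
begin

section \<open>The real Clifford algebra\<close>

text \<open>
  An element of the Clifford algebra of \<open>\<real>\<^sup>n\<close>, \<open>n = CARD('n)\<close>, is the family of its coordinates with
  respect to the basis \<open>e\<^sub>A\<close> (\<open>A\<close> a set of indices), where \<open>e\<^sub>A\<close> is the product of the \<open>e\<^sub>j\<close>, \<open>j \<in> A\<close>,
  in increasing order. The linear order on \<open>'n\<close> serves only to fix this basis.
\<close>

typedef 'n clifford = "UNIV :: ('n set \<Rightarrow> real) set"
  morphisms coord Clifford ..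

setup_lifting type_definition_clifford

lemma clifford_eq_iff: "x = y \<longleftrightarrow> (\<forall>A. coord x A = coord y A)"
  by transfer auto

instantiation clifford :: (type) real_vector
begin

lift_definition zero_clifford :: "'a clifford" is "\<lambda>A. 0" .
lift_definition plus_clifford :: "'a clifford \<Rightarrow> 'a clifford \<Rightarrow> 'a clifford" is "\<lambda>x y A. x A + y A" .
lift_definition minus_clifford :: "'a clifford \<Rightarrow> 'a clifford \<Rightarrow> 'a clifford" is "\<lambda>x y A. x A - y A" .
lift_definition uminus_clifford :: "'a clifford \<Rightarrow> 'a clifford" is "\<lambda>x A. - x A" .
lift_definition scaleR_clifford :: "real \<Rightarrow> 'a clifford \<Rightarrow> 'a clifford" is "\<lambda>r x A. r * x A" .

instance
  by standard (transfer; simp add: fun_eq_iff algebra_simps)+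

end

lemma coord_simps [simp]:
  "coord 0 A = 0"
  "coord (x + y) A = coord x A + coord y A"
  "coord (x - y) A = coord x A - coord y A"
  "coord (- x) A = - coord x A"
  "coord (r *\<^sub>R x) A = r * coord x A"
  by (transfer, simp)+

lemma coord_sum [simp]: "coord (\<Sum>i\<in>I. f i) A = (\<Sum>i\<in>I. coord (f i) A)"
  by (induction I rule: infinite_finite_induct) auto

lift_definition blade :: "'n set \<Rightarrow> 'n clifford" is "\<lambda>A B. if A = B then 1 else 0" .

lemma coord_blade: "coord (blade A) B = (if A = B then 1 else 0)"
  by transfer simp

instantiation clifford :: (finite) euclidean_space
begin

definition inner_clifford_def: "inner x y = (\<Sum>A\<in>UNIV. coord x A * coord y A)"

definition norm_clifford_def: "norm x = sqrt (\<Sum>A\<in>UNIV. coord x A * coord x A)"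

definition dist_clifford_def: "dist x y = norm (x - y :: 'a clifford)"

definition sgn_clifford_def: "sgn x = x /\<^sub>R norm (x :: 'a clifford)"

definition uniformity_clifford_def:
  "(uniformity :: ('a clifford \<times> 'a clifford) filter) =
    (INF e\<in>{0 <..}. principal {(x, y). dist x y < e})"

definition open_clifford_def:
  "open (U :: 'a clifford set) \<longleftrightarrow>
    (\<forall>x\<in>U. eventually (\<lambda>(x', y). x' = x \<longrightarrow> y \<in> U) uniformity)"

definition Basis_clifford_def: "Basis = range (blade :: 'a set \<Rightarrow> 'a clifford)"

instance
proof
  fix x y z :: "'a clifford" and r :: real and U :: "'a clifford set"
  show "inner x y = inner y x" by (simp add: inner_clifford_def mult.commute)
  show "inner (x + y) z = inner x z + inner y z"
    by (simp add: inner_clifford_def distrib_right sum.distrib)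
  show "inner (r *\<^sub>R x) y = r * inner x y"
    by (simp add: inner_clifford_def sum_distrib_left mult.assoc)
  show "0 \<le> inner x x" by (simp add: inner_clifford_def sum_nonneg)
  show "inner x x = 0 \<longleftrightarrow> x = 0"
    by (simp add: inner_clifford_def sum_nonneg_eq_0_iff clifford_eq_iff)
  show "norm x = sqrt (inner x x)" by (simp add: norm_clifford_def inner_clifford_def)
  show "dist x y = norm (x - y)" by (rule dist_clifford_def)
  show "sgn x = x /\<^sub>R norm x" by (rule sgn_clifford_def)
  show "(uniformity :: ('a clifford \<times> 'a clifford) filter)
      = (INF e\<in>{0 <..}. principal {(x, y). dist x y < e})" by (rule uniformity_clifford_def)
  show "open U \<longleftrightarrow> (\<forall>x\<in>U. eventually (\<lambda>(x', y). x' = x \<longrightarrow> y \<in> U) uniformity)"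
    by (rule open_clifford_def)
  show "(Basis :: 'a clifford set) \<noteq> {}" "finite (Basis :: 'a clifford set)"
    by (simp_all add: Basis_clifford_def)
  have in_blade: "inner w (blade A) = coord w A" for w :: "'a clifford" and A
    by (simp add: inner_clifford_def coord_blade if_distrib cong: if_cong)
  have inj: "blade A = blade B \<longleftrightarrow> A = B" for A B :: "'a set"
    by (metis coord_blade zero_neq_one)
  show "inner u v = (if u = v then 1 else 0)"
    if "u \<in> Basis" "v \<in> Basis" for u v :: "'a clifford"
    using that by (auto simp: Basis_clifford_def in_blade inj coord_blade)
  show "(\<forall>u\<in>Basis. inner x u = 0) \<longleftrightarrow> x = 0"
    by (simp add: Basis_clifford_def in_blade clifford_eq_iff)
qed

end

text \<open>
  \<open>e\<^sub>A e\<^sub>B = blade_sign A B \<cdot> e\<^sub>C\<close> with \<open>C\<close> the symmetric difference of \<open>A\<close> and \<open>B\<close>: each pair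
  \<open>a \<in> A\<close>, \<open>b \<in> B\<close> with \<open>b < a\<close> costs one transposition, each with \<open>b = a\<close> one factor \<open>e\<^sub>a\<^sup>2 = -1\<close>.
\<close>

definition blade_sign :: "'n::linorder set \<Rightarrow> 'n set \<Rightarrow> real"
  where "blade_sign A B = (\<Prod>a\<in>A. \<Prod>b\<in>B. if b \<le> a then -1 else 1)"

lemma prod_sym_diff:
  fixes f :: "'a \<Rightarrow> real"
  assumes "finite A" "finite B" and f: "\<And>x. f x * f x = 1"
  shows "prod f (sym_diff A B) = prod f A * prod f B"
proof -
  have A: "prod f A = prod f (A - B) * prod f (A \<inter> B)"
    using assms(1) by (metis Diff_disjoint Int_Diff_Un finite_Diff finite_Int inf_sup_aci(1)
        prod.Int_Diff mult.commute)
  have B: "prod f B = prod f (B - A) * prod f (A \<inter> B)"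
    using assms(2) by (metis prod.Int_Diff mult.commute inf_commute)
  have "prod f (A \<inter> B) * prod f (A \<inter> B) = 1"
    by (simp add: f flip: prod.distrib)
  moreover have "prod f (sym_diff A B) = prod f (A - B) * prod f (B - A)"
    using assms by (intro prod.union_disjoint) auto
  ultimately show ?thesis
    unfolding A B by (simp add: mult.assoc mult.left_commute)
qed

lemma blade_sign_sq: "blade_sign A B * blade_sign A B = 1"
  unfolding blade_sign_def prod.distrib[symmetric] by (intro prod.neutral ballI) auto

lemma blade_sign_sym_diff_left:
  fixes A B C :: "'n::{finite,linorder} set"
  shows "blade_sign (sym_diff A B) C = blade_sign A C * blade_sign B C"
  unfolding blade_sign_def
  by (rule prod_sym_diff) (auto simp flip: prod.distrib intro!: prod.neutral)

lemma blade_sign_sym_diff_right: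
  fixes A B C :: "'n::{finite,linorder} set"
  shows "blade_sign A (sym_diff B C) = blade_sign A B * blade_sign A C"
  unfolding blade_sign_def prod.distrib[symmetric]
  by (intro prod.cong refl prod_sym_diff) auto

lemma blade_sign_empty [simp]: "blade_sign {} B = 1" "blade_sign A {} = 1"
  by (simp_all add: blade_sign_def)

lemma bij_sym_diff: "bij (\<lambda>B. sym_diff A B)"
  by (rule involuntory_imp_bij) auto

instantiation clifford :: ("{finite,linorder}") real_algebra_1
begin

lift_definition one_clifford :: "'a clifford" is "\<lambda>A. if A = {} then 1 else 0" .

text \<open>The pairs \<open>(A, B)\<close> with symmetric difference \<open>C\<close> are those with \<open>B = sym_diff A C\<close>.\<close>

lift_definition times_clifford :: "'a clifford \<Rightarrow> 'a clifford \<Rightarrow> 'a clifford" is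
  "\<lambda>x y C. \<Sum>A\<in>UNIV. blade_sign A (sym_diff A C) * x A * y (sym_diff A C)" .

instance
proof
  fix x y z :: "'a clifford" and r :: real
  show "x * y * z = x * (y * z)"
  proof (transfer, rule ext)
    fix x y z :: "'a set \<Rightarrow> real" and D :: "'a set"
    let ?s = "blade_sign :: 'a set \<Rightarrow> 'a set \<Rightarrow> real"
    have "(\<Sum>C\<in>UNIV. ?s C (sym_diff C D) *
             (\<Sum>A\<in>UNIV. ?s A (sym_diff A C) * x A * y (sym_diff A C)) * z (sym_diff C D))
        = (\<Sum>A\<in>UNIV. \<Sum>C\<in>UNIV. ?s C (sym_diff C D) *
             (?s A (sym_diff A C) * x A * y (sym_diff A C)) * z (sym_diff C D))"
      unfolding sum_distrib_left sum_distrib_right by (rule sum.swap)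
    also have "\<dots> = (\<Sum>A\<in>UNIV. \<Sum>B\<in>UNIV. ?s A (sym_diff A D) * x A *
             (?s B (sym_diff B (sym_diff A D)) * y B * z (sym_diff B (sym_diff A D))))"
    proof (rule sum.cong[OF refl])
      fix A :: "'a set"
      have "(\<Sum>C\<in>UNIV. ?s C (sym_diff C D) *
               (?s A (sym_diff A C) * x A * y (sym_diff A C)) * z (sym_diff C D))
          = (\<Sum>B\<in>UNIV. ?s (sym_diff A B) (sym_diff (sym_diff A B) D) *
               (?s A (sym_diff A (sym_diff A B)) * x A * y (sym_diff A (sym_diff A B))) *
               z (sym_diff (sym_diff A B) D))"
        by (rule sum.reindex_bij_betw[OF bij_sym_diff, symmetric])
      also have "\<dots> = (\<Sum>B\<in>UNIV. ?s A (sym_diff A D) * x A *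
             (?s B (sym_diff B (sym_diff A D)) * y B * z (sym_diff B (sym_diff A D))))"
      proof (rule sum.cong[OF refl])
        fix B :: "'a set"
        define E where "E = sym_diff B (sym_diff A D)"
        have 1: "sym_diff A (sym_diff A B) = B" "sym_diff (sym_diff A B) D = E"
          "sym_diff A D = sym_diff B E"
          by (auto simp: E_def)
        show "?s (sym_diff A B) (sym_diff (sym_diff A B) D) *
               (?s A (sym_diff A (sym_diff A B)) * x A * y (sym_diff A (sym_diff A B))) *
               z (sym_diff (sym_diff A B) D)
            = ?s A (sym_diff A D) * x A *
             (?s B (sym_diff B (sym_diff A D)) * y B * z (sym_diff B (sym_diff A D)))"
          unfolding E_def[symmetric] 1(1,2) unfolding 1(3)
          unfolding blade_sign_sym_diff_left blade_sign_sym_diff_right by (simp only: ac_simps)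
      qed
      finally show "(\<Sum>C\<in>UNIV. ?s C (sym_diff C D) *
               (?s A (sym_diff A C) * x A * y (sym_diff A C)) * z (sym_diff C D))
          = (\<Sum>B\<in>UNIV. ?s A (sym_diff A D) * x A *
             (?s B (sym_diff B (sym_diff A D)) * y B * z (sym_diff B (sym_diff A D))))" .
    qed
    finally show "(\<Sum>C\<in>UNIV. ?s C (sym_diff C D) *
             (\<Sum>A\<in>UNIV. ?s A (sym_diff A C) * x A * y (sym_diff A C)) * z (sym_diff C D))
        = (\<Sum>A\<in>UNIV. ?s A (sym_diff A D) * x A *
             (\<Sum>B\<in>UNIV. ?s B (sym_diff B (sym_diff A D)) * y B * z (sym_diff B (sym_diff A D))))"
      unfolding sum_distrib_left .
  qed
  show "1 * x = x"
  proof (transfer, rule ext)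
    fix x :: "'a set \<Rightarrow> real" and C :: "'a set"
    have "(\<Sum>A\<in>UNIV. blade_sign A (sym_diff A C) * (if A = {} then 1 else 0) * x (sym_diff A C))
        = (\<Sum>A\<in>UNIV. if A = ({} :: 'a set) then x C else 0)"
      by (intro sum.cong refl) auto
    then show "(\<Sum>A\<in>UNIV. blade_sign A (sym_diff A C) * (if A = {} then 1 else 0) *
        x (sym_diff A C)) = x C" by simp
  qed
  show "x * 1 = x"
  proof (transfer, rule ext)
    fix x :: "'a set \<Rightarrow> real" and C :: "'a set"
    have "(\<Sum>A\<in>UNIV. blade_sign A (sym_diff A C) * x A * (if sym_diff A C = {} then 1 else 0))
        = (\<Sum>A\<in>UNIV. if A = C then x C else 0)"
      by (intro sum.cong refl) auto
    then show "(\<Sum>A\<in>UNIV. blade_sign A (sym_diff A C) * x A *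
        (if sym_diff A C = {} then 1 else 0)) = x C" by simp
  qed
  show "(x + y) * z = x * z + y * z" "x * (y + z) = x * y + x * z"
    by (transfer; simp add: algebra_simps sum.distrib)+
  show "r *\<^sub>R x * y = r *\<^sub>R (x * y)" "x * r *\<^sub>R y = r *\<^sub>R (x * y)"
    by (transfer; simp add: sum_distrib_left mult.assoc mult.left_commute)+
  show "(0 :: 'a clifford) \<noteq> 1"
    by transfer (metis zero_neq_one)
qed

end

definition gen :: "'n \<Rightarrow> 'n clifford"
  where "gen j = blade {j}"

lemma coord_times:
  fixes x y :: "'n::{finite,linorder} clifford"
  shows "coord (x * y) C = (\<Sum>A\<in>UNIV. blade_sign A (sym_diff A C) * coord x A * coord y (sym_diff A C))"
  by transfer simp

lemma blade_times:
  fixes A B :: "'n::{finite,linorder} set"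
  shows "blade A * blade B = blade_sign A B *\<^sub>R blade (sym_diff A B)"
proof (unfold clifford_eq_iff, rule allI)
  fix C :: "'n set"
  have "coord (blade A * blade B) C
      = (\<Sum>A'\<in>UNIV. if A' = A then (if sym_diff A B = C then blade_sign A B else 0) else 0)"
    unfolding coord_times coord_blade by (intro sum.cong refl) auto
  then show "coord (blade A * blade B) C = coord (blade_sign A B *\<^sub>R blade (sym_diff A B)) C"
    by (simp add: coord_blade)
qed

lemma blade_empty: "blade {} = (1 :: 'n::{finite,linorder} clifford)"
  by transfer auto

lemma blade_insert:
  fixes a :: "'n::{finite,linorder}"
  assumes "\<And>b. b \<in> A \<Longrightarrow> a < b"
  shows "blade (insert a A) = gen a * blade A"
proof -
  have "blade_sign {a} A = 1"
    using assms by (force simp: blade_sign_def intro!: prod.neutral)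
  moreover have "sym_diff {a} A = insert a A"
    using assms by force
  ultimately show ?thesis by (simp add: gen_def blade_times)
qed

lemma gen_sq: "gen j * gen j = (-1 :: 'n::{finite,linorder} clifford)"
  by (simp add: gen_def blade_times blade_sign_def blade_empty)

lemma gen_anticommute:
  fixes i j :: "'n::{finite,linorder}"
  assumes "i \<noteq> j"
  shows "gen i * gen j + gen j * gen i = 0"
proof -
  have "sym_diff {j} {i} = sym_diff {i} {j}" by auto
  then have "gen i * gen j + gen j * gen i
      = (blade_sign {i} {j} + blade_sign {j} {i}) *\<^sub>R blade (sym_diff {i} {j})"
    by (simp only: gen_def blade_times scaleR_add_left)
  moreover have "blade_sign {i} {j} + blade_sign {j} {i} = 0"
    using assms by (auto simp: blade_sign_def)
  ultimately show ?thesis by simp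
qed

definition cvec :: "real ^ 'n::finite \<Rightarrow> 'n clifford"
  where "cvec x = (\<Sum>j\<in>UNIV. (x $ j) *\<^sub>R gen j)"


section \<open>Differential operators\<close>

definition partial :: "'n \<Rightarrow> (real ^ 'n::finite \<Rightarrow> 'b::real_normed_vector) \<Rightarrow> real ^ 'n \<Rightarrow> 'b"
  where "partial j f x = frechet_derivative f (at x) (axis j 1)"

text \<open>\<open>C\<^sup>k\<close> on \<open>S\<close>; intended for open \<open>S\<close>.\<close>

primrec Ck_on :: "nat \<Rightarrow> (real ^ 'n::finite) set \<Rightarrow> (real ^ 'n \<Rightarrow> 'b::real_normed_vector) \<Rightarrow> bool"
  where
    "Ck_on 0 S f \<longleftrightarrow> continuous_on S f"
  | "Ck_on (Suc k) S f \<longleftrightarrow> (\<forall>x\<in>S. f differentiable (at x)) \<and> (\<forall>j. Ck_on k S (partial j f))"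

type_synonym 'n cfield = "(real, 'n) vec \<Rightarrow> 'n clifford"

definition dirac_shift :: "(real, 'n) vec \<Rightarrow> 'n::{finite,linorder} cfield \<Rightarrow> 'n cfield"
  where "dirac_shift \<alpha> f x = (\<Sum>j\<in>UNIV. gen j * (partial j f x - (\<alpha> $ j) *\<^sub>R f x))"

definition dirac :: "'n::{finite,linorder} cfield \<Rightarrow> 'n cfield"
  where "dirac f x = (\<Sum>j\<in>UNIV. gen j * partial j f x)"

definition monogenic_on :: "(real, 'n) vec set \<Rightarrow> 'n::{finite,linorder} cfield \<Rightarrow> bool"
  where "monogenic_on S f \<longleftrightarrow> Ck_on 1 S f \<and> (\<forall>x\<in>S. dirac f x = 0)"

definition star_like_0 :: "'a::real_vector set \<Rightarrow> bool"
  where "star_like_0 S \<longleftrightarrow> (\<forall>x\<in>S. \<forall>t\<in>{0..1}. t *\<^sub>R x \<in> S)"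


section \<open>The operators of the Almansi decomposition\<close>

definition I_op :: "real \<Rightarrow> 'n::finite cfield \<Rightarrow> 'n cfield"
  where "I_op s f x = integral {0..1} (\<lambda>t. t powr (s - 1) *\<^sub>R f (t *\<^sub>R x))"

text \<open>
  The bracket in \<open>a\<^sub>k\<close> and \<open>Q\<^sub>k\<close> is the integer part. It must round down: for monogenic \<open>f\<close> and
  the Euler operator \<open>E = \<Sum>\<^sub>j x\<^sub>j \<partial>\<^sub>j\<close> one has \<open>D\<^sup>2 (x\<^sup>2 f) = 4 (E + n/2) f\<close>, so that the left inverse
  \<open>Q\<^sub>2\<close> is \<open>1/4 I\<^bsub>n/2\<^esub>\<close>, whereas rounding up in \<open>[(k - 1)/2]\<close> would add a second factor
  \<open>I\<^bsub>n/2+1\<^esub>\<close>. Similarly \<open>D\<^sup>3 (x\<^sup>3 f) = -8 (E + n/2) (E + n/2 + 1) f\<close> requires \<open>[3/2]! = 1\<close>.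
\<close>

definition bracket :: "real \<Rightarrow> nat"
  where "bracket s = nat \<lfloor>s\<rfloor>"

definition a_const :: "nat \<Rightarrow> real"
  where "a_const k = (-2) ^ k * fact (bracket (real k / 2))"

definition Q_op :: "nat \<Rightarrow> 'n::finite cfield \<Rightarrow> 'n cfield"
  where "Q_op k f x = (1 / a_const k) *\<^sub>R
    foldr (\<lambda>i. I_op (real CARD('n) / 2 + real i)) [0..<Suc (bracket ((real k - 1) / 2))] f x"

definition almansi_factor :: "nat \<Rightarrow> 'n::{finite,linorder} cfield \<Rightarrow> 'n cfield"
  where "almansi_factor j f x = f x - cvec x ^ j * Q_op j ((dirac ^^ j) f) x"

text \<open>
  \<open>almansi_component k j g\<close> is the \<open>j\<close>-th component of \<open>g\<close> in the decomposition of length \<open>k\<close>. The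
  product of the factors with indices \<open>j + 1, \<dots>, k - 1\<close> is a composition, in which the factor with
  index \<open>k - 1\<close> is applied first.
\<close>

definition almansi_component :: "nat \<Rightarrow> nat \<Rightarrow> 'n::{finite,linorder} cfield \<Rightarrow> 'n cfield"
  where "almansi_component k j g =
    (let h = foldr almansi_factor [Suc j..<k] g in if j = 0 then h else Q_op j ((dirac ^^ j) h))"

end

theory Submission
  imports Defs
begin

text \<open>
  Multiplying by \<open>exp (- \<alpha> \<bullet> x)\<close> turns \<open>D - \<alpha>\<close> into \<open>D\<close>, so the claim is the Almansi decomposition of a
  solution \<open>g\<close> of \<open>D\<^sup>k g = 0\<close> into \<open>\<Sum>\<^sub>j x\<^sup>j g\<^sub>j\<close> with monogenic \<open>g\<^sub>j\<close>.

  For monogenic \<open>f\<close>, applying \<open>D\<close> to \<open>x\<^sup>j f\<close> lowers the power of \<open>x\<close> by one and replaces \<open>f\<close> by a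
  multiple of \<open>f\<close> (\<open>j\<close> even) or of \<open>(E + n/2 + m) f\<close> (\<open>j = 2 m + 1\<close>), \<open>E\<close> the Euler operator
  (\<open>dirac_cvec_power_times\<close>). The mean \<open>I\<^sub>s\<close> along rays inverts \<open>E + s\<close> from both sides, by the
  fundamental theorem of calculus (\<open>euler_I_op\<close>, \<open>I_op_euler\<close>). Hence \<open>D\<^sup>k (x\<^sup>k Q\<^sub>k h) = h\<close> for monogenic
  \<open>h\<close>, one factor of \<open>Q\<^sub>k\<close> being consumed at every second application of \<open>D\<close>. If \<open>D\<^bsup>k+1\<^esup> g = 0\<close>, then
  \<open>D\<^sup>k g\<close> is monogenic, so \<open>g - x\<^sup>k Q\<^sub>k D\<^sup>k g\<close> is annihilated by \<open>D\<^sup>k\<close>, and induction on \<open>k\<close> gives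
  existence (\<open>almansi_decomposition\<close>) together with the stated formulas.

  Uniqueness (\<open>almansi_unique\<close>) is also by induction: apply \<open>D\<close> to \<open>\<Sum>\<^sub>j x\<^sup>j \<psi>\<^sub>j = 0\<close> and cancel the factors
  \<open>E + n/2 + m\<close>, which are injective since \<open>I\<^bsub>n/2+m\<^esub>\<close> is a left inverse.

  Monogenicity asks only for \<open>C\<^sup>1\<close>, so an application of \<open>E + s\<close> could cost the derivative that the
  next \<open>D\<close> needs. In the existence part \<open>E + s\<close> only ever meets functions of the form \<open>I\<^sub>s h\<close>, on which it
  gives back the \<open>C\<^sup>1\<close> function \<open>h\<close>. In the uniqueness part the relation is first averaged by \<open>I\<^sub>1\<close>,
  which replaces \<open>\<psi>\<^sub>j\<close> by \<open>I\<^bsub>j+1\<^esub> \<psi>\<^sub>j\<close> and so has the same effect.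
\<close>


section \<open>Calculus with partial derivatives\<close>

lemma has_derivative_partial_eq:
  "(f has_derivative f') (at x) \<Longrightarrow> partial j f x = f' (axis j 1)"
  unfolding partial_def by (metis frechet_derivative_at)

lemma has_derivative_partials:
  fixes f :: "real ^ 'n \<Rightarrow> 'b::real_normed_vector"
  assumes "f differentiable (at x)"
  shows "(f has_derivative (\<lambda>v. \<Sum>j\<in>UNIV. (v $ j) *\<^sub>R partial j f x)) (at x)"
proof -
  let ?f' = "frechet_derivative f (at x)"
  have f': "(f has_derivative ?f') (at x)"
    using assms frechet_derivative_works by blast
  then interpret linear ?f'
    by (rule has_derivative_linear)
  have "?f' v = (\<Sum>j\<in>UNIV. (v $ j) *\<^sub>R partial j f x)" for v
  proof -
    have "?f' v = ?f' (\<Sum>j\<in>UNIV. (v $ j) *\<^sub>R axis j 1)"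
      using basis_expansion[of v] by (simp add: scalar_mult_eq_scaleR)
    also have "\<dots> = (\<Sum>j\<in>UNIV. (v $ j) *\<^sub>R partial j f x)"
      by (simp add: sum scale partial_def)
    finally show ?thesis .
  qed
  then have "?f' = (\<lambda>v. \<Sum>j\<in>UNIV. (v $ j) *\<^sub>R partial j f x)" by blast
  with f' show ?thesis by simp
qed

text \<open>
  Stated as an equivalence, so that both \<open>partial\<close> and differentiability, which are defined through
  \<open>has_derivative\<close>, inherit locality from it.
\<close>

lemma has_derivative_cong_open:
  assumes "open S" "x \<in> S" "\<And>y. y \<in> S \<Longrightarrow> f y = g y"
  shows "(f has_derivative f') (at x) \<longleftrightarrow> (g has_derivative f') (at x)"
  using has_derivative_transform_within_open[of f f' x UNIV S g]
    has_derivative_transform_within_open[of g f' x UNIV S f] assms by auto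

lemma partial_cong_open:
  assumes "open S" "x \<in> S" "\<And>y. y \<in> S \<Longrightarrow> f y = g y"
  shows "partial j f x = partial j g x"
  unfolding partial_def frechet_derivative_def using has_derivative_cong_open[OF assms] by simp

lemma differentiable_cong_open:
  assumes "open S" "x \<in> S" "\<And>y. y \<in> S \<Longrightarrow> f y = g y"
  shows "f differentiable (at x) \<longleftrightarrow> g differentiable (at x)"
  unfolding differentiable_def using has_derivative_cong_open[OF assms] by simp

lemma partial_add:
  assumes f: "f differentiable (at x)" and g: "g differentiable (at x)"
  shows "partial j (\<lambda>y. f y + g y) x = partial j f x + partial j g x"
  unfolding partial_def[of _ f] partial_def[of _ g]
  by (rule has_derivative_partial_eq[OF has_derivative_add[OF
        iffD1[OF frechet_derivative_works f] iffD1[OF frechet_derivative_works g]]])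

lemma partial_bounded_linear:
  assumes L: "bounded_linear L" and f: "f differentiable (at x)"
  shows "partial j (\<lambda>y. L (f y)) x = L (partial j f x)"
  unfolding partial_def[of _ f]
  by (rule has_derivative_partial_eq[OF bounded_linear.has_derivative[OF L
        iffD1[OF frechet_derivative_works f]]])

lemma differentiable_bounded_linear:
  assumes L: "bounded_linear L" and f: "f differentiable (at x)"
  shows "(\<lambda>y. L (f y)) differentiable (at x)"
  using bounded_linear.has_derivative[OF L iffD1[OF frechet_derivative_works f]]
  unfolding differentiable_def by fast

lemma differentiable_bounded_bilinear:
  assumes B: "bounded_bilinear mul" and f: "f differentiable (at x)" and g: "g differentiable (at x)"
  shows "(\<lambda>y. mul (f y) (g y)) differentiable (at x)"
  using bounded_bilinear.FDERIV[OF B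
      iffD1[OF frechet_derivative_works f] iffD1[OF frechet_derivative_works g]]
  unfolding differentiable_def by fast

lemma partial_bounded_bilinear:
  assumes B: "bounded_bilinear mul" and f: "f differentiable (at x)" and g: "g differentiable (at x)"
  shows "partial j (\<lambda>y. mul (f y) (g y)) x = mul (f x) (partial j g x) + mul (partial j f x) (g x)"
  unfolding partial_def[of _ f] partial_def[of _ g]
  by (rule has_derivative_partial_eq[OF bounded_bilinear.FDERIV[OF B
        iffD1[OF frechet_derivative_works f] iffD1[OF frechet_derivative_works g]]])

lemma partial_linear:
  assumes "bounded_linear L"
  shows "partial j L x = L (axis j 1)"
  using has_derivative_partial_eq[OF bounded_linear_imp_has_derivative[OF assms]] .

lemma partial_const: "partial j (\<lambda>y. c) x = 0"
  using has_derivative_partial_eq[OF has_derivative_const] .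


section \<open>Functions of class \<open>C\<^sup>k\<close>\<close>

lemma Ck_on_1_iff:
  "Ck_on 1 S f \<longleftrightarrow> (\<forall>x\<in>S. f differentiable (at x)) \<and> (\<forall>j. continuous_on S (partial j f))"
  by simp

lemma Ck_on_imp_continuous_on: "Ck_on k S f \<Longrightarrow> continuous_on S f"
proof (cases k)
  case (Suc m)
  then show "Ck_on k S f \<Longrightarrow> continuous_on S f"
    by (auto intro!: differentiable_imp_continuous_on differentiable_at_imp_differentiable_on)
qed simp

lemma Ck_on_Suc_imp_Ck_on: "Ck_on (Suc k) S f \<Longrightarrow> Ck_on k S f"
proof (induction k arbitrary: f)
  case 0
  then show ?case using Ck_on_imp_continuous_on[of "Suc 0"] by (simp only: Ck_on.simps(1))
qed auto

lemma Ck_on_mono: "Ck_on k S f \<Longrightarrow> m \<le> k \<Longrightarrow> Ck_on m S f"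
proof (induction k)
  case (Suc k)
  then show ?case using Ck_on_Suc_imp_Ck_on by (metis le_Suc_eq)
qed simp

lemma Ck_on_cong:
  assumes "open S"
  shows "Ck_on k S f \<Longrightarrow> (\<And>x. x \<in> S \<Longrightarrow> f x = g x) \<Longrightarrow> Ck_on k S g"
proof (induction k arbitrary: f g)
  case 0
  then show ?case by (metis Ck_on.simps(1) continuous_on_cong)
next
  case (Suc k)
  have "g differentiable (at x)" if "x \<in> S" for x
    using Suc.prems(1) differentiable_cong_open[OF assms that Suc.prems(2)] that by auto
  moreover have "Ck_on k S (partial j g)" for j
  proof (rule Suc.IH)
    show "Ck_on k S (partial j f)" using Suc.prems(1) by simp
    show "partial j f x = partial j g x" if "x \<in> S" for x
      using partial_cong_open[OF assms that Suc.prems(2)] .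
  qed
  ultimately show ?case by simp
qed

lemma Ck_on_const: "Ck_on k (S :: (real ^ 'n) set) (\<lambda>x. c)"
proof (induction k arbitrary: c)
  case (Suc k)
  have "partial j (\<lambda>x. c) = (\<lambda>x. 0)" for j :: 'n
    by (simp add: partial_const fun_eq_iff)
  with Suc show ?case by simp
qed simp

lemma Ck_on_linear:
  assumes "bounded_linear L"
  shows "Ck_on k S L"
proof (cases k)
  case (Suc m)
  have "partial j L = (\<lambda>x. L (axis j 1))" for j
    by (simp add: partial_linear[OF assms] fun_eq_iff)
  then show ?thesis
    using Suc Ck_on_const bounded_linear_imp_differentiable[OF assms] by auto
qed (use assms in \<open>simp add: linear_continuous_on\<close>)

lemma Ck_on_bounded_linear:
  assumes "open S" and L: "bounded_linear L"
  shows "Ck_on k S f \<Longrightarrow> Ck_on k S (\<lambda>x. L (f x))"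
proof (induction k arbitrary: f)
  case 0
  then show ?case by (simp add: bounded_linear.continuous_on[OF L])
next
  case (Suc k)
  have "Ck_on k S (partial j (\<lambda>x. L (f x)))" for j
    by (rule Ck_on_cong[OF assms(1), of _ "\<lambda>x. L (partial j f x)"])
      (use Suc in \<open>simp_all add: partial_bounded_linear[OF L]\<close>)
  then show ?case
    using Suc.prems differentiable_bounded_linear[OF L] by auto
qed

lemma Ck_on_add:
  assumes "open S"
  shows "Ck_on k S f \<Longrightarrow> Ck_on k S g \<Longrightarrow> Ck_on k S (\<lambda>x. f x + g x)"
proof (induction k arbitrary: f g)
  case 0
  then show ?case by (simp add: continuous_on_add)
next
  case (Suc k)
  have "Ck_on k S (partial j (\<lambda>x. f x + g x))" for j
    by (rule Ck_on_cong[OF assms(1), of _ "\<lambda>x. partial j f x + partial j g x"])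
      (use Suc in \<open>simp_all add: partial_add\<close>)
  then show ?case
    using Suc.prems by auto
qed

lemma Ck_on_scaleR: "open S \<Longrightarrow> Ck_on k S f \<Longrightarrow> Ck_on k S (\<lambda>x. c *\<^sub>R f x)"
  by (rule Ck_on_bounded_linear[OF _ bounded_linear_scaleR_right])

lemma Ck_on_diff:
  assumes "open S" "Ck_on k S f" "Ck_on k S g"
  shows "Ck_on k S (\<lambda>x. f x - g x)"
  using Ck_on_add[OF assms(1,2) Ck_on_scaleR[OF assms(1,3), of "- 1"]] by simp

lemma Ck_on_sum:
  assumes "open S"
  shows "(\<And>i. i \<in> I \<Longrightarrow> Ck_on k S (f i)) \<Longrightarrow> Ck_on k S (\<lambda>x. \<Sum>i\<in>I. f i x)"
  by (induction I rule: infinite_finite_induct) (auto intro: Ck_on_const Ck_on_add[OF assms])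

lemma Ck_on_bounded_bilinear:
  assumes "open S" and B: "bounded_bilinear mul"
  shows "Ck_on k S f \<Longrightarrow> Ck_on k S g \<Longrightarrow> Ck_on k S (\<lambda>x. mul (f x) (g x))"
proof (induction k arbitrary: f g)
  case 0
  then show ?case by (simp add: bounded_bilinear.continuous_on[OF B])
next
  case (Suc k)
  have "Ck_on k S (partial j (\<lambda>x. mul (f x) (g x)))" for j
  proof (rule Ck_on_cong[OF assms(1)])
    show "Ck_on k S (\<lambda>x. mul (f x) (partial j g x) + mul (partial j f x) (g x))"
      using Suc.prems Suc.prems[THEN Ck_on_Suc_imp_Ck_on]
      by (intro Ck_on_add[OF assms(1)] Suc.IH) simp_all
  qed (use Suc.prems in \<open>simp add: partial_bounded_bilinear[OF B]\<close>)
  then show ?case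
    using Suc.prems by (simp add: differentiable_bounded_bilinear[OF B])
qed

lemma partial_exp_inner:
  fixes a x :: "real ^ 'n"
  shows "partial j (\<lambda>y. exp (a \<bullet> y)) x = (a $ j) *\<^sub>R exp (a \<bullet> x)"
proof -
  have "((\<lambda>y. exp (a \<bullet> y)) has_derivative (\<lambda>v. exp (a \<bullet> x) * (a \<bullet> v))) (at x)"
    by (auto intro!: derivative_eq_intros)
  from has_derivative_partial_eq[OF this, of j] show ?thesis
    by (simp add: inner_axis)
qed

lemma differentiable_exp_inner: "(\<lambda>y. exp (a \<bullet> y :: real)) differentiable (at x)"
proof -
  have "((\<lambda>y. exp (a \<bullet> y)) has_derivative (\<lambda>v. exp (a \<bullet> x) * (a \<bullet> v))) (at x)"
    by (auto intro!: derivative_eq_intros)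
  then show ?thesis unfolding differentiable_def by fast
qed

lemma Ck_on_exp_inner:
  assumes "open S"
  shows "Ck_on k S (\<lambda>x. exp (a \<bullet> x))"
proof (induction k)
  case (Suc k)
  have "partial j (\<lambda>y. exp (a \<bullet> y)) = (\<lambda>x. (a $ j) *\<^sub>R exp (a \<bullet> x))" for j
    using partial_exp_inner by blast
  then show ?case
    using Ck_on_scaleR[OF assms Suc] by (simp add: differentiable_exp_inner)
qed (auto intro!: continuous_intros)


section \<open>The Dirac operator and multiplication by the vector variable\<close>

text \<open>
  The Euclidean norm of the coordinates is not submultiplicative in general; boundedness of the
  product comes from finite dimension.
\<close>

lemma bounded_bilinear_clifford_times:
  "bounded_bilinear ((*) :: 'n::{finite,linorder} clifford \<Rightarrow> 'n clifford \<Rightarrow> 'n clifford)"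
  unfolding bilinear_conv_bounded_bilinear[symmetric]
  by (auto simp: bilinear_def algebra_simps intro!: linearI)

lemma bounded_linear_clifford_times_left:
  "bounded_linear (\<lambda>x. a * x :: 'n::{finite,linorder} clifford)"
  using bounded_bilinear.bounded_linear_right[OF bounded_bilinear_clifford_times] .

lemma bounded_linear_cvec: "bounded_linear cvec"
  unfolding cvec_def
  by (intro bounded_linear_sum bounded_linear_scaleR_const bounded_linear_vec_nth)

lemma cvec_scaleR: "cvec (t *\<^sub>R x) = t *\<^sub>R cvec x"
  by (simp add: cvec_def scaleR_sum_right)

lemma cvec_axis: "cvec (axis j 1) = gen j"
proof -
  have "cvec (axis j 1) = (\<Sum>i\<in>UNIV. if i = j then gen i else 0)"
    unfolding cvec_def by (intro sum.cong) (auto simp: axis_def)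
  then show ?thesis by simp
qed

lemma clifford_scaleR_power:
  "(t *\<^sub>R (x :: 'n::{finite,linorder} clifford)) ^ j = t ^ j *\<^sub>R x ^ j"
  by (induction j) (simp_all add: mult.commute)

lemma gen_times_gen:
  "gen i * gen j = - (gen j * gen i) - (if i = j then 2 else 0) *\<^sub>R (1 :: 'n::{finite,linorder} clifford)"
proof (cases "i = j")
  case True
  have "(2::real) *\<^sub>R (1 :: 'n clifford) = 1 + 1" by (rule scaleR_2)
  with True show ?thesis by (simp add: gen_sq)
next
  case False
  with gen_anticommute[OF False] show ?thesis by (simp add: eq_neg_iff_add_eq_0)
qed

lemma gen_times_cvec:
  fixes x :: "real ^ 'n::{finite,linorder}"
  shows "gen j * cvec x = - (cvec x * gen j) - (2 * x $ j) *\<^sub>R 1"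
proof -
  have "gen j * cvec x = (\<Sum>i\<in>UNIV. (x $ i) *\<^sub>R (gen j * gen i))"
    by (simp add: cvec_def sum_distrib_left)
  also have "\<dots> = (\<Sum>i\<in>UNIV. - ((x $ i) *\<^sub>R (gen i * gen j))
      - (if i = j then (2 * x $ j) *\<^sub>R 1 else 0))"
  proof (intro sum.cong refl)
    fix i
    show "(x $ i) *\<^sub>R (gen j * gen i) = - ((x $ i) *\<^sub>R (gen i * gen j))
        - (if i = j then (2 * x $ j) *\<^sub>R 1 else 0)"
      unfolding gen_times_gen[of j i] by (auto simp: scaleR_diff_right mult.commute)
  qed
  also have "\<dots> = - (cvec x * gen j) - (2 * x $ j) *\<^sub>R 1"
    by (simp add: cvec_def sum_distrib_right sum_subtractf sum_negf)
  finally show ?thesis .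
qed

lemma differentiable_cvec: "cvec differentiable (at x)"
  by (rule bounded_linear_imp_differentiable[OF bounded_linear_cvec])

lemma partial_cvec_times:
  assumes "f differentiable (at x)"
  shows "partial j (\<lambda>y. cvec y * f y) x = cvec x * partial j f x + gen j * f x"
  using partial_bounded_bilinear[OF bounded_bilinear_clifford_times differentiable_cvec assms]
  by (simp add: partial_linear[OF bounded_linear_cvec] cvec_axis)

lemma differentiable_cvec_times:
  assumes "f differentiable (at x)"
  shows "(\<lambda>y. cvec y * f y) differentiable (at x)"
  using differentiable_bounded_bilinear[OF bounded_bilinear_clifford_times differentiable_cvec assms] .

lemma differentiable_cvec_power_times:
  assumes "f differentiable (at x)"
  shows "(\<lambda>y. cvec y ^ j * f y) differentiable (at x)"
  by (induction j) (simp_all add: assms mult.assoc differentiable_cvec_times)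

lemma Ck_on_cvec_power_times:
  assumes "open S" "Ck_on k S f"
  shows "Ck_on k S (\<lambda>y. cvec y ^ j * f y)"
proof (induction j)
  case (Suc j)
  then show ?case
    using Ck_on_bounded_bilinear[OF assms(1) bounded_bilinear_clifford_times
        Ck_on_linear[OF bounded_linear_cvec] Suc]
    by (simp add: mult.assoc)
qed (simp add: assms)

lemma dirac_cong_open:
  assumes "open S" "x \<in> S" "\<And>y. y \<in> S \<Longrightarrow> f y = g y"
  shows "dirac f x = dirac g x"
  unfolding dirac_def using partial_cong_open[OF assms] by simp

lemma dirac_add:
  assumes "f differentiable (at x)" "g differentiable (at x)"
  shows "dirac (\<lambda>y. f y + g y) x = dirac f x + dirac g x"
  by (simp add: dirac_def partial_add[OF assms] distrib_left sum.distrib)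

lemma dirac_scaleR:
  assumes "f differentiable (at x)"
  shows "dirac (\<lambda>y. c *\<^sub>R f y) x = c *\<^sub>R dirac f x"
  by (simp add: dirac_def partial_bounded_linear[OF bounded_linear_scaleR_right assms] scaleR_sum_right)

lemma differentiable_scaleR_right:
  "f differentiable (at x) \<Longrightarrow> (\<lambda>y. c *\<^sub>R f y) differentiable (at x)"
  by (rule differentiable_bounded_linear[OF bounded_linear_scaleR_right])

lemma dirac_diff:
  assumes "f differentiable (at x)" "g differentiable (at x)"
  shows "dirac (\<lambda>y. f y - g y) x = dirac f x - dirac g x"
  using dirac_add[OF assms(1) differentiable_scaleR_right[OF assms(2)], of "- 1"]
  by (simp add: dirac_scaleR[OF assms(2), of "- 1", simplified])

lemma dirac_zero: "dirac (\<lambda>y. 0) x = 0"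
  by (simp add: dirac_def partial_const)

lemma dirac_sum:
  assumes "finite I" "\<And>i. i \<in> I \<Longrightarrow> f i differentiable (at x)"
  shows "dirac (\<lambda>y. \<Sum>i\<in>I. f i y) x = (\<Sum>i\<in>I. dirac (f i) x)"
  using assms
  by (induction I) (simp_all add: dirac_zero dirac_add)

definition euler :: "('n::finite) cfield \<Rightarrow> 'n cfield"
  where "euler f x = (\<Sum>j\<in>UNIV. (x $ j) *\<^sub>R partial j f x)"

lemma euler_cong_open:
  assumes "open S" "x \<in> S" "\<And>y. y \<in> S \<Longrightarrow> f y = g y"
  shows "euler f x = euler g x"
  unfolding euler_def using partial_cong_open[OF assms] by simp

lemma euler_scaleR:
  assumes "f differentiable (at x)"
  shows "euler (\<lambda>y. c *\<^sub>R f y) x = c *\<^sub>R euler f x"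
  by (simp add: euler_def partial_bounded_linear[OF bounded_linear_scaleR_right assms]
      scaleR_sum_right mult.commute)

lemma euler_zero: "euler (\<lambda>y. 0) x = 0"
  by (simp add: euler_def partial_const)

text \<open>
  Moving \<open>e\<^sub>j\<close> past \<open>x\<close> by \<open>gen_times_cvec\<close> produces \<open>- x D f\<close> and, from the commutator terms, the Euler
  operator; differentiating the factor \<open>x\<close> produces \<open>\<Sum>\<^sub>j e\<^sub>j\<^sup>2 f = - n f\<close>.
\<close>

lemma dirac_cvec_times:
  fixes f :: "'n::{finite,linorder} cfield"
  assumes "f differentiable (at x)"
  shows "dirac (\<lambda>y. cvec y * f y) x
    = - (real CARD('n) *\<^sub>R f x + 2 *\<^sub>R euler f x + cvec x * dirac f x)"
proof -
  have "dirac (\<lambda>y. cvec y * f y) x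
      = (\<Sum>j\<in>UNIV. (gen j * cvec x) * partial j f x + (gen j * gen j) * f x)"
    by (simp add: dirac_def partial_cvec_times[OF assms] distrib_left mult.assoc)
  also have "\<dots> = (\<Sum>j\<in>UNIV. - (cvec x * (gen j * partial j f x))
      - 2 *\<^sub>R ((x $ j) *\<^sub>R partial j f x) - f x)"
    by (simp add: gen_times_cvec gen_sq left_diff_distrib mult.assoc)
  also have "\<dots> = - (real CARD('n) *\<^sub>R f x + 2 *\<^sub>R euler f x + cvec x * dirac f x)"
    unfolding sum_subtractf sum_negf dirac_def euler_def sum_distrib_left scaleR_sum_right
      sum_constant_scaleR by simp
  finally show ?thesis .
qed

lemma euler_cvec_times:
  assumes "f differentiable (at x)"
  shows "euler (\<lambda>y. cvec y * f y) x = cvec x * f x + cvec x * euler f x"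
proof -
  have "euler (\<lambda>y. cvec y * f y) x
      = (\<Sum>j\<in>UNIV. (x $ j) *\<^sub>R gen j * f x) + (\<Sum>j\<in>UNIV. cvec x * ((x $ j) *\<^sub>R partial j f x))"
    by (simp add: euler_def partial_cvec_times[OF assms] scaleR_add_right sum.distrib add.commute)
  then show ?thesis
    by (simp only: euler_def cvec_def sum_distrib_left sum_distrib_right)
qed

text \<open>
  Since \<open>x\<^sup>2 = - |x|\<^sup>2\<close> is scalar, \<open>D\<close> commutes with \<open>x\<^sup>2\<close> up to the gradient of this scalar; here this
  results from applying \<open>dirac_cvec_times\<close> twice.
\<close>

lemma dirac_cvec_cvec_times:
  fixes f :: "'n::{finite,linorder} cfield"
  assumes "f differentiable (at x)"
  shows "dirac (\<lambda>y. cvec y * (cvec y * f y)) x = cvec x * (cvec x * dirac f x) - 2 *\<^sub>R (cvec x * f x)"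
  unfolding dirac_cvec_times[OF differentiable_cvec_times[OF assms]] dirac_cvec_times[OF assms]
    euler_cvec_times[OF assms]
  by (simp add: algebra_simps)

section \<open>Monogenic functions\<close>

lemma monogenic_on_imp_Ck_on: "monogenic_on S f \<Longrightarrow> Ck_on 1 S f"
  unfolding monogenic_on_def by (rule conjunct1)

lemma monogenic_on_imp_dirac: "monogenic_on S f \<Longrightarrow> x \<in> S \<Longrightarrow> dirac f x = 0"
  unfolding monogenic_on_def by (rule bspec[OF conjunct2])

lemma monogenic_on_imp_differentiable:
  "monogenic_on S f \<Longrightarrow> x \<in> S \<Longrightarrow> f differentiable (at x)"
  unfolding monogenic_on_def by (auto simp del: One_nat_def simp: Ck_on_1_iff)

lemma monogenic_on_cong:
  assumes "open S" "monogenic_on S f" "\<And>x. x \<in> S \<Longrightarrow> f x = g x"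
  shows "monogenic_on S g"
  unfolding monogenic_on_def
proof (intro conjI ballI)
  show "Ck_on 1 S g"
    by (rule Ck_on_cong[OF assms(1), where f = f])
      (use assms(2,3) in \<open>auto simp: monogenic_on_def simp del: One_nat_def\<close>)
  show "dirac g x = 0" if "x \<in> S" for x
    using dirac_cong_open[OF assms(1) that, of f g] assms(2,3) that by (simp add: monogenic_on_def)
qed

lemma monogenic_on_scaleR:
  assumes "open S" "monogenic_on S f"
  shows "monogenic_on S (\<lambda>x. c *\<^sub>R f x)"
  using assms Ck_on_scaleR[OF assms(1), of 1 f]
  by (auto simp: monogenic_on_def dirac_scaleR monogenic_on_imp_differentiable[OF assms(2)]
      simp del: One_nat_def)

lemma monogenic_on_add:
  assumes "open S" "monogenic_on S f" "monogenic_on S g"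
  shows "monogenic_on S (\<lambda>x. f x + g x)"
  using assms Ck_on_add[OF assms(1), of 1 f g]
  by (auto simp: monogenic_on_def dirac_add monogenic_on_imp_differentiable[OF assms(2)]
      monogenic_on_imp_differentiable[OF assms(3)] simp del: One_nat_def)

lemma monogenic_on_diff:
  assumes "open S" "monogenic_on S f" "monogenic_on S g"
  shows "monogenic_on S (\<lambda>x. f x - g x)"
  using monogenic_on_add[OF assms(1,2) monogenic_on_scaleR[OF assms(1,3), of "- 1"]] by simp

text \<open>
  The coefficient function that remains when \<open>D\<close> has taken one factor \<open>x\<close> away from \<open>x\<^sup>j f\<close>, for
  monogenic \<open>f\<close>.
\<close>

definition dirac_step :: "nat \<Rightarrow> 'n::finite cfield \<Rightarrow> 'n cfield"
  where "dirac_step j f x = (if even j then - (real j *\<^sub>R f x)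
    else - (2 *\<^sub>R euler f x + (real CARD('n) + 2 * real (j div 2)) *\<^sub>R f x))"

text \<open>
  For \<open>j = 0\<close> the truncated exponent \<open>j - 1\<close> is harmless because \<open>dirac_step 0 f = 0\<close>. The induction goes
  in steps of two: raising \<open>j\<close> by two adds the term \<open>- 2 x\<close> of \<open>dirac_cvec_cvec_times\<close>, that is,
  subtracts \<open>2 f\<close> from the coefficient function.
\<close>

lemma dirac_cvec_power_times:
  fixes f :: "'n::{finite,linorder} cfield"
  assumes f: "f differentiable (at x)" and D: "dirac f x = 0"
  shows "dirac (\<lambda>y. cvec y ^ j * f y) x = cvec x ^ (j - 1) * dirac_step j f x"
proof (induction j rule: nat_induct2)
  case (step j)
  have "dirac (\<lambda>y. cvec y ^ (j + 2) * f y) x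
      = dirac (\<lambda>y. cvec y * (cvec y * (cvec y ^ j * f y))) x"
    by (simp add: mult.assoc)
  also have "\<dots> = cvec x * (cvec x * (cvec x ^ (j - 1) * dirac_step j f x))
      - 2 *\<^sub>R (cvec x * (cvec x ^ j * f x))"
    by (simp add: dirac_cvec_cvec_times[OF differentiable_cvec_power_times[OF f]] step)
  also have "\<dots> = cvec x ^ (j + 1) * (dirac_step j f x - 2 *\<^sub>R f x)"
    by (cases j) (simp_all add: dirac_step_def algebra_simps)
  also have "dirac_step j f x - 2 *\<^sub>R f x = dirac_step (j + 2) f x"
    by (simp add: dirac_step_def algebra_simps)
  finally show ?case by simp
qed (simp_all add: D dirac_step_def dirac_cvec_times[OF f])


section \<open>Weighted means along rays\<close>

locale star_domain =
  fixes \<Omega> :: "(real ^ 'n::{finite,linorder}) set"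
  assumes open_dom: "open \<Omega>" and star_dom: "star_like_0 \<Omega>"
begin

lemma ray: "x \<in> \<Omega> \<Longrightarrow> 0 \<le> t \<Longrightarrow> t \<le> 1 \<Longrightarrow> t *\<^sub>R x \<in> \<Omega>"
  using star_dom unfolding star_like_0_def by auto

lemma continuous_on_ray:
  assumes "continuous_on \<Omega> f" "x \<in> \<Omega>"
  shows "continuous_on {0..1} (\<lambda>t. f (t *\<^sub>R x))"
  by (rule continuous_on_compose2[OF assms(1)]) (auto intro!: continuous_intros ray assms(2))

text \<open>
  For \<open>0 < s < 1\<close> the weight is unbounded at \<open>0\<close>, but it is absolutely integrable, and \<open>f\<close> is bounded on
  the compact segment from \<open>0\<close> to \<open>x\<close>.
\<close>

lemma I_op_integrable:
  fixes f :: "(real, 'n) vec \<Rightarrow> 'b::euclidean_space"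
  assumes f: "continuous_on \<Omega> f" and x: "x \<in> \<Omega>" and s: "s > 0"
  shows "(\<lambda>t. t powr (s - 1) *\<^sub>R f (t *\<^sub>R x)) integrable_on {0..1}"
proof -
  have c: "continuous_on {0..1} (\<lambda>t. f (t *\<^sub>R x))"
    by (rule continuous_on_ray[OF f x])
  have "(\<lambda>t. t powr (s - 1)) absolutely_integrable_on {0..1}"
    using integrable_on_powr_from_0[of "s - 1" 1] s
    by (subst absolutely_integrable_on_iff_nonneg) auto
  moreover have "bilinear (\<lambda>(y::'b) (r::real). r *\<^sub>R y)"
    by (auto simp: bilinear_def algebra_simps intro!: linearI)
  moreover have "bounded ((\<lambda>t. f (t *\<^sub>R x)) ` {0..1})"
    using compact_continuous_image[OF c] by (simp add: compact_imp_bounded)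
  ultimately have "(\<lambda>t. t powr (s - 1) *\<^sub>R f (t *\<^sub>R x)) absolutely_integrable_on {0..1}"
    using absolutely_integrable_bounded_measurable_product
      [OF _ continuous_imp_measurable_on_sets_lebesgue[OF c]] by fastforce
  then show ?thesis
    by (rule set_lebesgue_integral_eq_integral(1))
qed

lemma I_op_cong:
  assumes "\<And>y. y \<in> \<Omega> \<Longrightarrow> f y = g y" "x \<in> \<Omega>"
  shows "I_op s f x = I_op s g x"
  unfolding I_op_def by (intro integral_cong) (simp add: assms ray)

lemma I_op_scaleR: "I_op s (\<lambda>y. c *\<^sub>R f y) x = c *\<^sub>R I_op s f x"
  unfolding I_op_def integral_cmul[symmetric] by (simp add: mult.commute)

lemma I_op_sum:
  assumes "finite J" "\<And>j. j \<in> J \<Longrightarrow> continuous_on \<Omega> (g j)" "x \<in> \<Omega>" "s > 0"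
  shows "I_op s (\<lambda>y. \<Sum>j\<in>J. g j y) x = (\<Sum>j\<in>J. I_op s (g j) x)"
  unfolding I_op_def scaleR_sum_right
  by (rule integral_sum[OF assms(1)]) (rule I_op_integrable[OF assms(2-4)])

lemma I_op_lincomb:
  assumes "\<And>j. continuous_on \<Omega> (g j)" "x \<in> \<Omega>" "s > 0"
  shows "I_op s (\<lambda>y. \<Sum>j\<in>(UNIV :: 'j::finite set). c j *\<^sub>R g j y) x = (\<Sum>j\<in>UNIV. c j *\<^sub>R I_op s (g j) x)"
  using assms by (subst I_op_sum) (auto intro: continuous_intros simp: I_op_scaleR)

lemma continuous_on_powr_ray:
  fixes f :: "(real, 'n) vec \<Rightarrow> 'b::real_normed_vector"
  assumes "continuous_on \<Omega> f" "0 < s" "U \<subseteq> \<Omega>"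
  shows "continuous_on (U \<times> cbox 0 1) (\<lambda>(x, t). t powr s *\<^sub>R f (t *\<^sub>R x))"
proof -
  have "continuous_on (U \<times> cbox 0 1) (\<lambda>p. snd p powr s)"
    using assms(2) by (intro continuous_on_powr' continuous_on_snd continuous_on_const continuous_on_id) auto
  moreover have "continuous_on (U \<times> cbox 0 1) (\<lambda>p. f (snd p *\<^sub>R fst p))"
  proof (rule continuous_on_compose2[OF assms(1)])
    show "continuous_on (U \<times> cbox 0 1) (\<lambda>p. snd p *\<^sub>R fst p)"
      by (intro continuous_intros)
    show "(\<lambda>p. snd p *\<^sub>R fst p) ` (U \<times> cbox 0 1) \<subseteq> \<Omega>"
      using assms(3) by (auto intro!: ray)
  qed
  ultimately show ?thesis
    unfolding split_beta by (rule continuous_on_scaleR)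
qed

text \<open>
  Differentiation under the integral sign. The chain rule for \<open>x \<mapsto> t x\<close> contributes a factor \<open>t\<close>, which
  raises the index of the mean by one and cancels the singularity of the weight: the differentiated
  integrand is jointly continuous up to \<open>t = 0\<close>.
\<close>

lemma I_op_has_derivative:
  assumes f: "Ck_on 1 \<Omega> f" and s: "s > 0" and x: "x \<in> \<Omega>"
  shows "(I_op s f has_derivative (\<lambda>v. \<Sum>j\<in>UNIV. (v $ j) *\<^sub>R I_op (s + 1) (partial j f) x)) (at x)"
proof -
  have df: "f differentiable (at y)" if "y \<in> \<Omega>" for y
    using f that by simp
  have cp: "continuous_on \<Omega> (partial j f)" for j
    using f by simp
  obtain r where r: "r > 0" "ball x r \<subseteq> \<Omega>"
    using open_dom x open_contains_ball by blast
  define F :: "(real, 'n) vec \<Rightarrow> real \<Rightarrow> _"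
    where "F y t = Blinfun (\<lambda>v. t powr s *\<^sub>R (\<Sum>j\<in>UNIV. (v $ j) *\<^sub>R partial j f (t *\<^sub>R y)))" for y t
  have F: "blinfun_apply (F y t) = (\<lambda>v. t powr s *\<^sub>R (\<Sum>j\<in>UNIV. (v $ j) *\<^sub>R partial j f (t *\<^sub>R y)))" for y t
    unfolding F_def
    by (rule bounded_linear_Blinfun_apply)
      (intro bounded_linear_compose[OF bounded_linear_scaleR_right] bounded_linear_sum
        bounded_linear_scaleR_const bounded_linear_vec_nth)
  have contF: "continuous_on (ball x r \<times> cbox 0 1) (\<lambda>(y, t). F y t)"
    unfolding split_beta
  proof (rule continuous_on_blinfun_componentwise)
    fix v :: "(real, 'n) vec"
    have "continuous_on \<Omega> (\<lambda>z. \<Sum>j\<in>UNIV. (v $ j) *\<^sub>R partial j f z)"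
      by (intro continuous_intros cp)
    from continuous_on_powr_ray[OF this s r(2)]
    show "continuous_on (ball x r \<times> cbox 0 1) (\<lambda>p. blinfun_apply (F (fst p) (snd p)) v)"
      by (simp add: F split_beta)
  qed
  have der: "((\<lambda>y. t powr (s - 1) *\<^sub>R f (t *\<^sub>R y)) has_derivative blinfun_apply (F y t))
      (at y within ball x r)" if y: "y \<in> ball x r" and t: "t \<in> cbox 0 1" for y t
  proof -
    have "t *\<^sub>R y \<in> \<Omega>" using ray[of y t] r y t by auto
    from has_derivative_partials[OF df[OF this]]
    have "((\<lambda>y. t powr (s - 1) *\<^sub>R f (t *\<^sub>R y)) has_derivative
        (\<lambda>v. t powr (s - 1) *\<^sub>R (\<Sum>j\<in>UNIV. ((t *\<^sub>R v) $ j) *\<^sub>R partial j f (t *\<^sub>R y)))) (at y)"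
      by (intro has_derivative_scaleR_right has_derivative_compose[where g=f and f="\<lambda>y. t *\<^sub>R y"])
        (auto intro!: derivative_eq_intros)
    moreover have "t powr (s - 1) *\<^sub>R (\<Sum>j\<in>UNIV. ((t *\<^sub>R v) $ j) *\<^sub>R partial j f (t *\<^sub>R y))
        = blinfun_apply (F y t) v" for v
    proof -
      have "(\<Sum>j\<in>UNIV. ((t *\<^sub>R v) $ j) *\<^sub>R partial j f (t *\<^sub>R y))
          = t *\<^sub>R (\<Sum>j\<in>UNIV. (v $ j) *\<^sub>R partial j f (t *\<^sub>R y))"
        by (simp add: scaleR_sum_right)
      moreover have "t powr (s - 1) * t = t powr s"
        using t powr_mult_base[of t "s - 1"] by (simp add: mult.commute)
      ultimately show ?thesis by (simp add: F)
    qed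
    ultimately show ?thesis
      by (simp add: has_derivative_at_withinI)
  qed
  have "((\<lambda>y. integral (cbox 0 1) (\<lambda>t. t powr (s - 1) *\<^sub>R f (t *\<^sub>R y))) has_derivative
      blinfun_apply (integral (cbox 0 1) (F x))) (at x within ball x r)"
  proof (rule leibniz_rule[OF der _ contF])
    fix y assume "y \<in> ball x r"
    then show "(\<lambda>t. t powr (s - 1) *\<^sub>R f (t *\<^sub>R y)) integrable_on cbox 0 1"
      using I_op_integrable[OF Ck_on_imp_continuous_on[OF f] _ s, of y] r by auto
  qed (use r in auto)
  moreover have "blinfun_apply (integral (cbox 0 1) (F x)) v
      = (\<Sum>j\<in>UNIV. (v $ j) *\<^sub>R I_op (s + 1) (partial j f) x)" for v
  proof -
    have "F x integrable_on cbox 0 1"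
    proof (rule integrable_continuous)
      show "continuous_on (cbox 0 1) (F x)"
        using continuous_on_compose2[OF contF, of "cbox 0 1" "Pair x"] r
        by (force intro: continuous_intros)
    qed
    then have "blinfun_apply (integral (cbox 0 1) (F x)) v
        = integral (cbox 0 1) (\<lambda>t. blinfun_apply (F x t) v)"
      using blinfun_apply_integral by blast
    also have "\<dots> = I_op (s + 1) (\<lambda>y. \<Sum>j\<in>UNIV. (v $ j) *\<^sub>R partial j f y) x"
      by (simp add: F I_op_def)
    also have "\<dots> = (\<Sum>j\<in>UNIV. (v $ j) *\<^sub>R I_op (s + 1) (partial j f) x)"
      using s by (intro I_op_lincomb cp x) auto
    finally show ?thesis .
  qed
  then have "blinfun_apply (integral (cbox 0 1) (F x))
      = (\<lambda>v. \<Sum>j\<in>UNIV. (v $ j) *\<^sub>R I_op (s + 1) (partial j f) x)" ..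
  ultimately have "((\<lambda>y. integral (cbox 0 1) (\<lambda>t. t powr (s - 1) *\<^sub>R f (t *\<^sub>R y))) has_derivative
      (\<lambda>v. \<Sum>j\<in>UNIV. (v $ j) *\<^sub>R I_op (s + 1) (partial j f) x)) (at x within ball x r)"
    by simp
  then have "(I_op s f has_derivative
      (\<lambda>v. \<Sum>j\<in>UNIV. (v $ j) *\<^sub>R I_op (s + 1) (partial j f) x)) (at x within ball x r)"
    by (simp add: I_op_def[abs_def])
  then show ?thesis
    using at_within_open[of x "ball x r"] r by simp
qed

lemma partial_I_op:
  assumes f: "Ck_on 1 \<Omega> f" and s: "s > 0" and x: "x \<in> \<Omega>"
  shows "partial j (I_op s f) x = I_op (s + 1) (partial j f) x"
proof -
  have "partial j (I_op s f) x = (\<Sum>i\<in>UNIV. if i = j then I_op (s + 1) (partial i f) x else 0)"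
    unfolding has_derivative_partial_eq[OF I_op_has_derivative[OF assms]]
    by (intro sum.cong) (auto simp: axis_def)
  then show ?thesis by simp
qed

lemma continuous_on_I_op:
  assumes "continuous_on \<Omega> f" "s > 1"
  shows "continuous_on \<Omega> (I_op s f)"
  using integral_continuous_on_param[OF continuous_on_powr_ray[OF assms(1), of "s - 1" \<Omega>]] assms(2)
  by (simp add: I_op_def[abs_def])

lemma Ck_on_1_I_op:
  assumes f: "Ck_on 1 \<Omega> f" and s: "s > 0"
  shows "Ck_on 1 \<Omega> (I_op s f)"
  unfolding Ck_on_1_iff
proof (intro conjI ballI allI)
  show "I_op s f differentiable (at x)" if "x \<in> \<Omega>" for x
    using I_op_has_derivative[OF f s that] unfolding differentiable_def by fast
  show "continuous_on \<Omega> (partial j (I_op s f))" for j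
    using continuous_on_I_op[of "partial j f" "s + 1"] f s
    by (subst continuous_on_cong[OF refl partial_I_op[OF f s]]) auto
qed

text \<open>
  The integrand is the derivative of \<open>t\<^sup>s f (t x)\<close> on the open interval. Both inversion formulas below
  come from this identity.
\<close>

lemma ray_fundamental_theorem:
  assumes f: "Ck_on 1 \<Omega> f" and s: "s > 0" and x: "x \<in> \<Omega>"
  shows "((\<lambda>t. t powr s *\<^sub>R (\<Sum>j\<in>UNIV. (x $ j) *\<^sub>R partial j f (t *\<^sub>R x))
      + (s * t powr (s - 1)) *\<^sub>R f (t *\<^sub>R x)) has_integral f x) {0..1}"
proof -
  have "((\<lambda>t. t powr s *\<^sub>R (\<Sum>j\<in>UNIV. (x $ j) *\<^sub>R partial j f (t *\<^sub>R x))
      + (s * t powr (s - 1)) *\<^sub>R f (t *\<^sub>R x)) has_integral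
      1 powr s *\<^sub>R f (1 *\<^sub>R x) - 0 powr s *\<^sub>R f (0 *\<^sub>R x)) {0..1}"
  proof (rule fundamental_theorem_of_calculus_interior)
    show "continuous_on {0..1} (\<lambda>t. t powr s *\<^sub>R f (t *\<^sub>R x))"
      using s by (intro continuous_on_scaleR continuous_on_powr'
          continuous_on_ray[OF Ck_on_imp_continuous_on[OF f] x] continuous_intros) auto
    fix t :: real assume t: "t \<in> {0<..<1}"
    then have "f differentiable (at (t *\<^sub>R x))"
      using f ray[OF x, of t] by simp
    from has_derivative_partials[OF this]
    have "((\<lambda>t. f (t *\<^sub>R x)) has_derivative
        (\<lambda>u. \<Sum>j\<in>UNIV. ((u *\<^sub>R x) $ j) *\<^sub>R partial j f (t *\<^sub>R x))) (at t)"
      by (rule has_derivative_compose[rotated]) (auto intro!: derivative_eq_intros)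
    then have "((\<lambda>t. f (t *\<^sub>R x)) has_vector_derivative
        (\<Sum>j\<in>UNIV. (x $ j) *\<^sub>R partial j f (t *\<^sub>R x))) (at t)"
      by (simp add: has_vector_derivative_def scaleR_sum_right)
    moreover have "((\<lambda>t. t powr s) has_real_derivative s * t powr (s - 1)) (at t)"
      using t by (auto intro!: derivative_eq_intros)
    ultimately show "((\<lambda>t. t powr s *\<^sub>R f (t *\<^sub>R x)) has_vector_derivative
      t powr s *\<^sub>R (\<Sum>j\<in>UNIV. (x $ j) *\<^sub>R partial j f (t *\<^sub>R x))
      + (s * t powr (s - 1)) *\<^sub>R f (t *\<^sub>R x)) (at t)"
      using has_vector_derivative_scaleR by blast
  qed simp
  then show ?thesis using s by simp
qed

lemma euler_I_op:
  assumes f: "Ck_on 1 \<Omega> f" and s: "s > 0" and x: "x \<in> \<Omega>"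
  shows "euler (I_op s f) x + s *\<^sub>R I_op s f x = f x"
proof -
  have cp: "continuous_on \<Omega> (partial j f)" for j
    using f by simp
  have "euler (I_op s f) x = I_op (s + 1) (\<lambda>y. \<Sum>j\<in>UNIV. (x $ j) *\<^sub>R partial j f y) x"
    unfolding euler_def partial_I_op[OF assms]
    using s by (intro I_op_lincomb[symmetric] cp x) auto
  then have E: "euler (I_op s f) x
      = integral {0..1} (\<lambda>t. t powr s *\<^sub>R (\<Sum>j\<in>UNIV. (x $ j) *\<^sub>R partial j f (t *\<^sub>R x)))"
    by (simp add: I_op_def)
  have "s *\<^sub>R I_op s f x = integral {0..1} (\<lambda>t. (s * t powr (s - 1)) *\<^sub>R f (t *\<^sub>R x))"
    unfolding I_op_def by (simp flip: scaleR_scaleR)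
  moreover have "(\<lambda>t. (s * t powr (s - 1)) *\<^sub>R f (t *\<^sub>R x)) integrable_on {0..1}"
    using I_op_integrable[OF Ck_on_imp_continuous_on[OF f] x s]
    by (simp add: integrable_cmul flip: scaleR_scaleR)
  moreover have "(\<lambda>t. t powr s *\<^sub>R (\<Sum>j\<in>UNIV. (x $ j) *\<^sub>R partial j f (t *\<^sub>R x))) integrable_on {0..1}"
    using I_op_integrable[of "\<lambda>z. \<Sum>j\<in>UNIV. (x $ j) *\<^sub>R partial j f z" x "s + 1"] x s
    by (simp add: continuous_intros cp)
  ultimately show ?thesis
    using integral_unique[OF ray_fundamental_theorem[OF assms]] unfolding E
    by (subst (asm) integral_add) auto
qed

lemma I_op_euler:
  assumes f: "Ck_on 1 \<Omega> f" and s: "s > 0" and x: "x \<in> \<Omega>"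
  shows "I_op s (\<lambda>y. euler f y + s *\<^sub>R f y) x = f x"
proof -
  have "I_op s (\<lambda>y. euler f y + s *\<^sub>R f y) x
      = integral {0..1} (\<lambda>t. t powr s *\<^sub>R (\<Sum>j\<in>UNIV. (x $ j) *\<^sub>R partial j f (t *\<^sub>R x))
      + (s * t powr (s - 1)) *\<^sub>R f (t *\<^sub>R x))"
    unfolding I_op_def
  proof (rule integral_cong)
    fix t :: real assume t: "t \<in> {0..1}"
    have "euler f (t *\<^sub>R x) = t *\<^sub>R (\<Sum>j\<in>UNIV. (x $ j) *\<^sub>R partial j f (t *\<^sub>R x))"
      by (simp add: euler_def scaleR_sum_right)
    moreover have "t powr (s - 1) * t = t powr s"
      using t powr_mult_base[of t "s - 1"] by (simp add: mult.commute)
    ultimately show "t powr (s - 1) *\<^sub>R (euler f (t *\<^sub>R x) + s *\<^sub>R f (t *\<^sub>R x))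
        = t powr s *\<^sub>R (\<Sum>j\<in>UNIV. (x $ j) *\<^sub>R partial j f (t *\<^sub>R x))
        + (s * t powr (s - 1)) *\<^sub>R f (t *\<^sub>R x)"
      by (simp add: scaleR_add_right mult.commute)
  qed
  then show ?thesis
    using integral_unique[OF ray_fundamental_theorem[OF assms]] by simp
qed

lemma I_op_add:
  assumes "continuous_on \<Omega> f" "continuous_on \<Omega> g" "x \<in> \<Omega>" "s > 0"
  shows "I_op s (\<lambda>y. f y + g y) x = I_op s f x + I_op s g x"
  unfolding I_op_def scaleR_add_right
  by (rule integral_add) (rule I_op_integrable; use assms in simp)+

lemma I_op_bounded_linear:
  assumes "bounded_linear L" "continuous_on \<Omega> f" "x \<in> \<Omega>" "s > 0"
  shows "I_op s (\<lambda>y. L (f y)) x = L (I_op s f x)"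
  using integral_linear[OF I_op_integrable[OF assms(2-4)] assms(1)]
  by (simp add: I_op_def o_def linear_simps(5)[OF assms(1)])

lemma I_op_zero: "(\<And>y. y \<in> \<Omega> \<Longrightarrow> f y = 0) \<Longrightarrow> x \<in> \<Omega> \<Longrightarrow> I_op s f x = 0"
  using I_op_cong[of f "\<lambda>y. 0" x s] by (simp add: I_op_def)

text \<open>
  The point is that \<open>D\<close> maps means to means, so that \<open>I\<^sub>s\<close> preserves monogenicity.
\<close>

lemma dirac_I_op:
  assumes f: "Ck_on 1 \<Omega> f" and s: "s > 0" and x: "x \<in> \<Omega>"
  shows "dirac (I_op s f) x = I_op (s + 1) (dirac f) x"
proof -
  have cp: "continuous_on \<Omega> (partial j f)" for j
    using f by simp
  have "dirac (I_op s f) x = (\<Sum>j\<in>UNIV. I_op (s + 1) (\<lambda>y. gen j * partial j f y) x)"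
    unfolding dirac_def partial_I_op[OF assms]
    using s by (intro sum.cong refl I_op_bounded_linear[symmetric] cp x
        bounded_linear_clifford_times_left) auto
  also have "\<dots> = I_op (s + 1) (\<lambda>y. \<Sum>j\<in>UNIV. gen j * partial j f y) x"
    using s by (intro I_op_sum[symmetric] x
        bounded_linear.continuous_on[OF bounded_linear_clifford_times_left] cp) auto
  finally show ?thesis
    by (simp add: dirac_def[abs_def])
qed

lemma monogenic_on_I_op:
  assumes "monogenic_on \<Omega> f" "s > 0"
  shows "monogenic_on \<Omega> (I_op s f)"
  unfolding monogenic_on_def
proof (intro conjI ballI)
  note f = monogenic_on_imp_Ck_on[OF assms(1)]
  show "Ck_on 1 \<Omega> (I_op s f)"
    by (rule Ck_on_1_I_op[OF f assms(2)])
  show "dirac (I_op s f) x = 0" if "x \<in> \<Omega>" for x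
    unfolding dirac_I_op[OF f assms(2) that]
    by (rule I_op_zero[OF monogenic_on_imp_dirac[OF assms(1)] that])
qed

text \<open>
  The resolvent identity for \<open>I\<^sub>s = (E + s)\<^sup>-\<^sup>1\<close>: write \<open>I\<^sub>s f = I\<^sub>r (E + r) I\<^sub>s f\<close> and
  \<open>E + r = (E + s) + (r - s)\<close>.
\<close>

lemma I_op_resolvent:
  assumes f: "Ck_on 1 \<Omega> f" and s: "s > 0" and r: "r > 0" and x: "x \<in> \<Omega>"
  shows "I_op s f x - I_op r f x = (r - s) *\<^sub>R I_op r (I_op s f) x"
proof -
  have u: "Ck_on 1 \<Omega> (I_op s f)" by (rule Ck_on_1_I_op[OF f s])
  have "I_op s f x = I_op r (\<lambda>y. euler (I_op s f) y + r *\<^sub>R I_op s f y) x"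
    by (rule I_op_euler[OF u r x, symmetric])
  also have "\<dots> = I_op r (\<lambda>y. f y + (r - s) *\<^sub>R I_op s f y) x"
  proof (rule I_op_cong[OF _ x])
    fix y assume "y \<in> \<Omega>"
    from euler_I_op[OF f s this]
    show "euler (I_op s f) y + r *\<^sub>R I_op s f y = f y + (r - s) *\<^sub>R I_op s f y"
      by (simp add: algebra_simps)
  qed
  also have "\<dots> = I_op r f x + (r - s) *\<^sub>R I_op r (I_op s f) x"
    by (subst I_op_add)
      (simp_all add: I_op_scaleR Ck_on_imp_continuous_on[OF f] Ck_on_imp_continuous_on[OF u]
        continuous_on_scaleR r x)
  finally show ?thesis by simp
qed

text \<open>
  The difference \<open>I\<^sub>s f - I\<^sub>r f\<close> in the resolvent identity is antisymmetric in \<open>r\<close> and \<open>s\<close>, as is the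
  factor \<open>r - s\<close>.
\<close>

lemma I_op_commute:
  assumes f: "Ck_on 1 \<Omega> f" and s: "s > 0" and r: "r > 0" and x: "x \<in> \<Omega>"
  shows "I_op r (I_op s f) x = I_op s (I_op r f) x"
proof (cases "r = s")
  case False
  have "(r - s) *\<^sub>R I_op r (I_op s f) x = (r - s) *\<^sub>R I_op s (I_op r f) x"
  proof -
    have "(r - s) *\<^sub>R I_op r (I_op s f) x = - ((s - r) *\<^sub>R I_op s (I_op r f) x)"
      unfolding I_op_resolvent[OF f s r x, symmetric] I_op_resolvent[OF f r s x, symmetric] by simp
    then show ?thesis by (simp flip: scaleR_minus_left)
  qed
  with False show ?thesis by simp
qed simp

end


section \<open>The operators \<open>Q\<^sub>k\<close> as right inverses\<close>

lemma bracket_half: "bracket (real k / 2) = k div 2"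
  using floor_divide_of_nat_eq[of k 2, where ?'a = real] by (simp add: bracket_def)

lemma a_const_nonzero: "a_const k \<noteq> 0"
  by (simp add: a_const_def)

lemma a_const_0: "a_const 0 = 1"
  by (simp add: a_const_def bracket_def)

lemma a_const_Suc: "a_const (Suc j) = - (if even j then 2 else real (Suc j)) * a_const j"
proof (cases "even j")
  case True
  then show ?thesis by (auto simp: a_const_def bracket_half simp del: of_nat_Suc elim!: evenE)
next
  case False
  then obtain m where "j = 2 * m + 1" by (rule oddE)
  then show ?thesis by (simp add: a_const_def bracket_half del: of_nat_Suc) (simp add: algebra_simps)
qed

definition mean_chain :: "nat \<Rightarrow> 'n::finite cfield \<Rightarrow> 'n cfield"
  where "mean_chain m = foldr (\<lambda>i. I_op (real CARD('n) / 2 + real i)) [0..<m]"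

text \<open>
  This is \<open>Q\<^sub>k\<close> for \<open>k \<ge> 1\<close>, and the identity for \<open>k = 0\<close>, where \<open>Q_op 0\<close> would be \<open>I\<^bsub>n/2\<^esub>\<close>. With this
  convention the recursion in \<open>k\<close> and the component of index \<open>0\<close> are not exceptional.
\<close>

definition almansi_lift :: "nat \<Rightarrow> 'n::finite cfield \<Rightarrow> 'n cfield"
  where "almansi_lift k h x = (1 / a_const k) *\<^sub>R mean_chain ((k + 1) div 2) h x"

lemma almansi_lift_0: "almansi_lift 0 h = h"
  by (simp add: almansi_lift_def mean_chain_def a_const_0 fun_eq_iff)

lemma Q_op_eq_almansi_lift:
  assumes "k \<ge> 1"
  shows "Q_op k h = almansi_lift k h"
proof -
  have "bracket ((real k - 1) / 2) = (k - 1) div 2"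
    using bracket_half[of "k - 1"] assms by (simp add: of_nat_diff)
  moreover have "Suc ((k - 1) div 2) = (k + 1) div 2"
    using assms by (cases k) simp_all
  ultimately show ?thesis
    by (simp add: Q_op_def almansi_lift_def mean_chain_def fun_eq_iff del: upt_Suc)
qed

context star_domain
begin

lemma monogenic_on_foldr_I_op:
  assumes "monogenic_on \<Omega> h"
  shows "monogenic_on \<Omega> (foldr (\<lambda>i. I_op (real CARD('n) / 2 + real i)) is h)"
  using assms by (induction "is") (auto intro!: monogenic_on_I_op add_pos_nonneg)

lemma foldr_I_op_commute:
  assumes h: "monogenic_on \<Omega> h" and x: "x \<in> \<Omega>"
  defines "F \<equiv> \<lambda>i::nat. I_op (real CARD('n) / 2 + real i)"
  shows "foldr F is (F m h) x = F m (foldr F is h) x"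
  using x
proof (induction "is" arbitrary: x)
  case (Cons i "is")
  have "Ck_on 1 \<Omega> (foldr F is h)"
    unfolding F_def by (rule monogenic_on_imp_Ck_on[OF monogenic_on_foldr_I_op[OF h]])
  then have "F i (F m (foldr F is h)) x = F m (F i (foldr F is h)) x"
    unfolding F_def using Cons.prems by (intro I_op_commute) (auto intro!: add_pos_nonneg)
  moreover have "F i (foldr F is (F m h)) x = F i (F m (foldr F is h)) x"
    unfolding F_def by (rule I_op_cong[OF Cons.IH[unfolded F_def] Cons.prems])
  ultimately show ?case by simp
qed simp

text \<open>
  The factor of largest index is the innermost one by definition, but it is the first that has to be
  cancelled when \<open>D\<close> is applied, so it is moved to the outside.
\<close>

lemma mean_chain_Suc:
  assumes "monogenic_on \<Omega> h" "x \<in> \<Omega>"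
  shows "mean_chain (Suc m) h x = I_op (real CARD('n) / 2 + real m) (mean_chain m h) x"
  using foldr_I_op_commute[OF assms] by (simp add: mean_chain_def)

lemma monogenic_on_mean_chain: "monogenic_on \<Omega> h \<Longrightarrow> monogenic_on \<Omega> (mean_chain m h)"
  unfolding mean_chain_def by (rule monogenic_on_foldr_I_op)

lemma monogenic_on_almansi_lift: "monogenic_on \<Omega> h \<Longrightarrow> monogenic_on \<Omega> (almansi_lift k h)"
  unfolding almansi_lift_def[abs_def]
  by (intro monogenic_on_scaleR open_dom monogenic_on_mean_chain)

text \<open>
  For odd \<open>k = j + 1 = 2 m + 1\<close> the operator \<open>E + n/2 + m\<close> in \<open>dirac_step\<close> cancels the mean
  \<open>I\<^bsub>n/2+m\<^esub>\<close>, which \<open>Q\<^sub>k\<close> has and \<open>Q\<^bsub>k-1\<^esub>\<close> has not; for even \<open>k\<close> both have the same means. The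
  constants \<open>a\<^sub>k\<close> absorb the remaining numerical factors.
\<close>

lemma dirac_step_almansi_lift:
  assumes h: "monogenic_on \<Omega> h" and x: "x \<in> \<Omega>"
  shows "dirac_step (Suc j) (almansi_lift (Suc j) h) x = almansi_lift j h x"
proof (cases "even j")
  case True
  define m where "m = j div 2"
  define s where "s = real CARD('n) / 2 + real m"
  have jm: "Suc j div 2 = m" "(Suc j + 1) div 2 = Suc m" "(j + 1) div 2 = m"
    using True by (auto simp: m_def)
  have s: "s > 0" by (simp add: s_def add_pos_nonneg)
  let ?u = "mean_chain m h"
  have u: "Ck_on 1 \<Omega> ?u"
    by (rule monogenic_on_imp_Ck_on[OF monogenic_on_mean_chain[OF h]])
  have d: "I_op s ?u differentiable (at x)"
    by (rule monogenic_on_imp_differentiable[OF monogenic_on_I_op[OF monogenic_on_mean_chain[OF h] s] x])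
  have l: "almansi_lift (Suc j) h y = (1 / a_const (Suc j)) *\<^sub>R I_op s ?u y" if "y \<in> \<Omega>" for y
    unfolding almansi_lift_def jm mean_chain_Suc[OF h that] s_def ..
  have "euler (almansi_lift (Suc j) h) x = (1 / a_const (Suc j)) *\<^sub>R euler (I_op s ?u) x"
    using euler_cong_open[OF open_dom x l] euler_scaleR[OF d] by simp
  then have "dirac_step (Suc j) (almansi_lift (Suc j) h) x
      = (- 2 / a_const (Suc j)) *\<^sub>R (euler (I_op s ?u) x + s *\<^sub>R I_op s ?u x)"
    using True by (simp add: dirac_step_def l[OF x] jm s_def algebra_simps add_divide_distrib)
  also have "\<dots> = (- 2 / a_const (Suc j)) *\<^sub>R ?u x"
    by (simp only: euler_I_op[OF u s x])
  also have "- 2 / a_const (Suc j) = 1 / a_const j"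
    using True a_const_nonzero[of j] by (simp add: a_const_Suc)
  finally show ?thesis
    unfolding almansi_lift_def jm .
next
  case False
  then have "(Suc j + 1) div 2 = (j + 1) div 2" by presburger
  moreover have "- (real (Suc j) * (1 / a_const (Suc j))) = 1 / a_const j"
    using False a_const_nonzero[of j] by (simp add: a_const_Suc divide_simps del: of_nat_Suc)
  ultimately show ?thesis
    using False by (simp add: dirac_step_def almansi_lift_def del: of_nat_Suc flip: scaleR_minus_left)
qed

lemma dirac_cvec_power_almansi_lift:
  assumes h: "monogenic_on \<Omega> h" and x: "x \<in> \<Omega>"
  shows "dirac (\<lambda>y. cvec y ^ Suc j * almansi_lift (Suc j) h y) x = cvec x ^ j * almansi_lift j h x"
proof -
  have m: "monogenic_on \<Omega> (almansi_lift (Suc j) h)"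
    by (rule monogenic_on_almansi_lift[OF h])
  have "dirac (\<lambda>y. cvec y ^ Suc j * almansi_lift (Suc j) h y) x
      = cvec x ^ (Suc j - 1) * dirac_step (Suc j) (almansi_lift (Suc j) h) x"
    by (rule dirac_cvec_power_times) (rule monogenic_on_imp_differentiable[OF m x],
        rule monogenic_on_imp_dirac[OF m x])
  then show ?thesis
    unfolding dirac_step_almansi_lift[OF h x] diff_Suc_1 .
qed

lemma dirac_funpow_cvec_power_almansi_lift:
  assumes h: "monogenic_on \<Omega> h"
  shows "i \<le> k \<Longrightarrow> x \<in> \<Omega> \<Longrightarrow>
    (dirac ^^ i) (\<lambda>y. cvec y ^ k * almansi_lift k h y) x = cvec x ^ (k - i) * almansi_lift (k - i) h x"
proof (induction i arbitrary: x)
  case (Suc i)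
  have "(dirac ^^ Suc i) (\<lambda>y. cvec y ^ k * almansi_lift k h y) x
      = dirac (\<lambda>y. cvec y ^ (k - i) * almansi_lift (k - i) h y) x"
    unfolding funpow.simps(2) o_apply
    by (rule dirac_cong_open[OF open_dom Suc.prems(2)]) (rule Suc.IH; use Suc.prems in simp)
  also have "k - i = Suc (k - Suc i)"
    using Suc.prems by simp
  finally show ?case
    by (simp only: dirac_cvec_power_almansi_lift[OF h Suc.prems(2)])
qed simp


section \<open>Existence of the decomposition\<close>

text \<open>
  The regularity required is weaker than \<open>C\<^sup>k\<close>: only the iterates of \<open>D\<close> are asked to be \<open>C\<^sup>1\<close>. For
  monogenic \<open>h\<close> the summand \<open>x\<^sup>k Q\<^sub>k h\<close> has it whenever \<open>h\<close> is \<open>C\<^sup>1\<close>, so that it survives the induction.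
\<close>

definition polymonogenic :: "nat \<Rightarrow> 'n cfield \<Rightarrow> bool"
  where "polymonogenic k g \<longleftrightarrow>
    (\<forall>i<k. Ck_on 1 \<Omega> ((dirac ^^ i) g)) \<and> (\<forall>x\<in>\<Omega>. (dirac ^^ k) g x = 0)"

lemma dirac_funpow_diff:
  assumes "\<And>i. i < k \<Longrightarrow> Ck_on 1 \<Omega> ((dirac ^^ i) f)" "\<And>i. i < k \<Longrightarrow> Ck_on 1 \<Omega> ((dirac ^^ i) g)"
  shows "i \<le> k \<Longrightarrow> x \<in> \<Omega> \<Longrightarrow>
    (dirac ^^ i) (\<lambda>y. f y - g y) x = (dirac ^^ i) f x - (dirac ^^ i) g x"
proof (induction i arbitrary: x)
  case (Suc i)
  have "(dirac ^^ Suc i) (\<lambda>y. f y - g y) x = dirac (\<lambda>y. (dirac ^^ i) f y - (dirac ^^ i) g y) x"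
    unfolding funpow.simps(2) o_apply
    by (rule dirac_cong_open[OF open_dom Suc.prems(2)]) (rule Suc.IH; use Suc.prems in simp)
  also have "\<dots> = (dirac ^^ Suc i) f x - (dirac ^^ Suc i) g x"
    using assms[of i] Suc.prems by (simp add: dirac_diff)
  finally show ?case .
qed simp

text \<open>
  With \<open>Q\<^sub>0\<close> read as the identity, the iterates \<open>D\<^sup>i (x\<^sup>k Q\<^sub>k h) = x\<^bsup>k-i\<^esup> Q\<^bsub>k-i\<^esub> h\<close> are \<open>C\<^sup>1\<close> and end with
  \<open>h\<close> at \<open>i = k\<close>; for \<open>h = D\<^sup>k g\<close> this is exactly what has to be removed from \<open>g\<close>.
\<close>

lemma polymonogenic_almansi_factor:
  assumes g: "polymonogenic (Suc k) g" and k: "k \<ge> 1"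
  shows "polymonogenic k (almansi_factor k g)"
proof -
  let ?h = "(dirac ^^ k) g"
  let ?f = "\<lambda>y. cvec y ^ k * almansi_lift k ?h y"
  have h: "monogenic_on \<Omega> ?h"
    using g unfolding polymonogenic_def monogenic_on_def by simp
  have eq: "almansi_factor k g = (\<lambda>y. g y - ?f y)"
    by (simp add: almansi_factor_def[abs_def] Q_op_eq_almansi_lift[OF k])
  have lift: "Ck_on 1 \<Omega> (almansi_lift (k - i) ?h)" for i
    by (rule monogenic_on_imp_Ck_on[OF monogenic_on_almansi_lift[OF h]])
  have f: "Ck_on 1 \<Omega> ((dirac ^^ i) ?f)" if "i < k" for i
    by (rule Ck_on_cong[OF open_dom Ck_on_cvec_power_times[OF open_dom lift, of "k - i" i]])
      (use dirac_funpow_cvec_power_almansi_lift[OF h, of i k] that in simp)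
  have gi: "Ck_on 1 \<Omega> ((dirac ^^ i) g)" if "i < k" for i
    using g that unfolding polymonogenic_def by simp
  have diff: "(dirac ^^ i) (\<lambda>y. g y - ?f y) x = (dirac ^^ i) g x - (dirac ^^ i) ?f x"
    if "i \<le> k" "x \<in> \<Omega>" for i x
    by (rule dirac_funpow_diff[OF gi f that])
  show ?thesis
    unfolding polymonogenic_def eq
  proof (intro conjI allI ballI impI)
    fix i assume i: "i < k"
    show "Ck_on 1 \<Omega> ((dirac ^^ i) (\<lambda>y. g y - ?f y))"
      by (rule Ck_on_cong[OF open_dom Ck_on_diff[OF open_dom gi[OF i] f[OF i]]])
        (use diff i in simp)
  next
    fix x assume x: "x \<in> \<Omega>"
    show "(dirac ^^ k) (\<lambda>y. g y - ?f y) x = 0"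
      using diff[OF order_refl x] dirac_funpow_cvec_power_almansi_lift[OF h order_refl x]
      by (simp add: almansi_lift_0)
  qed
qed

lemma almansi_component_Suc:
  "j < k \<Longrightarrow> almansi_component (Suc k) j g = almansi_component k j (almansi_factor k g)"
  by (simp add: almansi_component_def)

lemma almansi_component_last:
  "almansi_component (Suc k) k g = almansi_lift k ((dirac ^^ k) g)"
  by (cases k) (simp_all add: almansi_component_def almansi_lift_0 Q_op_eq_almansi_lift)

text \<open>
  The innermost factor of the product, of index \<open>k\<close>, splits off the top component; the remaining
  factors form the product belonging to the shorter decomposition of the remainder.
\<close>

theorem almansi_decomposition:
  "polymonogenic k g \<Longrightarrow> (\<forall>j<k. monogenic_on \<Omega> (almansi_component k j g)) \<and>
    (\<forall>x\<in>\<Omega>. g x = (\<Sum>j<k. cvec x ^ j * almansi_component k j g x))"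
proof (induction k arbitrary: g)
  case 0
  then show ?case by (simp add: polymonogenic_def)
next
  case (Suc k)
  have "monogenic_on \<Omega> ((dirac ^^ k) g)"
    using Suc.prems unfolding polymonogenic_def monogenic_on_def by simp
  then have last: "monogenic_on \<Omega> (almansi_component (Suc k) k g)"
    unfolding almansi_component_last by (rule monogenic_on_almansi_lift)
  show ?case
  proof (cases "k = 0")
    case True
    then show ?thesis using last almansi_component_last[of 0 g] by (simp add: almansi_lift_0)
  next
    case False
    let ?g = "almansi_factor k g"
    have IH: "\<forall>j<k. monogenic_on \<Omega> (almansi_component k j ?g)"
      "\<forall>x\<in>\<Omega>. ?g x = (\<Sum>j<k. cvec x ^ j * almansi_component k j ?g x)"
      using Suc.IH[OF polymonogenic_almansi_factor[OF Suc.prems]] False by auto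
    have "g x = (\<Sum>j<Suc k. cvec x ^ j * almansi_component (Suc k) j g x)" if "x \<in> \<Omega>" for x
    proof -
      have "(\<Sum>j<Suc k. cvec x ^ j * almansi_component (Suc k) j g x)
          = ?g x + cvec x ^ k * almansi_component (Suc k) k g x"
        using IH(2) that by (simp add: almansi_component_Suc)
      also have "\<dots> = g x"
        using False by (simp add: almansi_factor_def almansi_component_last Q_op_eq_almansi_lift)
      finally show ?thesis ..
    qed
    then show ?thesis
      using IH(1) last by (metis almansi_component_Suc less_Suc_eq)
  qed
qed


section \<open>Uniqueness of the decomposition\<close>

text \<open>
  The homogeneity of \<open>x\<^sup>j\<close> shifts the index of the mean, so that averaging respects the form of an
  Almansi sum.
\<close>

lemma I_op_cvec_power_times:
  assumes f: "continuous_on \<Omega> f" and s: "s > 0" and x: "x \<in> \<Omega>"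
  shows "I_op s (\<lambda>y. cvec y ^ j * f y) x = cvec x ^ j * I_op (s + real j) f x"
proof -
  have "I_op s (\<lambda>y. cvec y ^ j * f y) x
      = integral {0..1} (\<lambda>t. t powr (s + real j - 1) *\<^sub>R (cvec x ^ j * f (t *\<^sub>R x)))"
    unfolding I_op_def
  proof (rule integral_cong)
    fix t :: real assume t: "t \<in> {0..1}"
    have "t powr (s - 1) * t ^ j = t powr (s + real j - 1)"
    proof (cases "t = 0")
      case False
      then show ?thesis
        using t by (simp add: powr_realpow[symmetric] powr_add[symmetric] algebra_simps)
    qed simp
    then show "t powr (s - 1) *\<^sub>R (cvec (t *\<^sub>R x) ^ j * f (t *\<^sub>R x))
        = t powr (s + real j - 1) *\<^sub>R (cvec x ^ j * f (t *\<^sub>R x))"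
      by (simp add: cvec_scaleR clifford_scaleR_power)
  qed
  also have "\<dots> = I_op (s + real j) (\<lambda>y. cvec x ^ j * f y) x"
    by (simp add: I_op_def)
  also have "\<dots> = cvec x ^ j * I_op (s + real j) f x"
    using s by (intro I_op_bounded_linear bounded_linear_clifford_times_left f x) auto
  finally show ?thesis .
qed

text \<open>
  For odd \<open>j\<close>, \<open>I\<^sub>s\<close> with \<open>s = n/2 + (j - 1)/2\<close> is a left inverse of the operator \<open>E + s\<close> in
  \<open>dirac_step\<close>.
\<close>

lemma zero_if_dirac_step_zero:
  assumes f: "Ck_on 1 \<Omega> f" and j: "j \<ge> 1" and "\<And>y. y \<in> \<Omega> \<Longrightarrow> dirac_step j f y = 0" and x: "x \<in> \<Omega>"
  shows "f x = 0"
proof (cases "even j")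
  case True
  then show ?thesis using assms(3)[OF x] j by (simp add: dirac_step_def)
next
  case False
  define s where "s = real CARD('n) / 2 + real (j div 2)"
  have s: "s > 0" by (simp add: s_def add_pos_nonneg)
  have "2 *\<^sub>R (euler f y + s *\<^sub>R f y) = - dirac_step j f y" for y
  proof -
    have "2 * s = real CARD('n) + 2 * real (j div 2)" by (simp add: s_def)
    with False show ?thesis by (simp add: dirac_step_def scaleR_add_right)
  qed
  then have "euler f y + s *\<^sub>R f y = 0" if "y \<in> \<Omega>" for y
    using assms(3)[OF that] by (metis neg_equal_0_iff_equal scaleR_eq_0_iff zero_neq_numeral)
  then have "I_op s (\<lambda>y. euler f y + s *\<^sub>R f y) x = 0"
    by (rule I_op_zero[OF _ x])
  then show ?thesis using I_op_euler[OF f s x] by simp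
qed

text \<open>
  The functions \<open>\<theta>\<^sub>j = I\<^bsub>j+1\<^esub> \<psi>\<^sub>j\<close> satisfy the same relation, obtained by averaging with \<open>I\<^sub>1\<close>. They have
  the advantage that \<open>E \<theta>\<^sub>j = \<psi>\<^sub>j - (j + 1) \<theta>\<^sub>j\<close> is again monogenic, in particular \<open>C\<^sup>1\<close>. Applying \<open>D\<close> to
  their relation therefore gives a relation with one summand less between the monogenic functions
  \<open>dirac_step (j + 1) \<theta>\<^bsub>j+1\<^esub>\<close>. By induction these vanish, hence so do \<open>\<theta>\<^bsub>j+1\<^esub>\<close> and
  \<open>\<psi>\<^bsub>j+1\<^esub> = (E + j + 2) \<theta>\<^bsub>j+1\<^esub>\<close>, and the original relation reduces to \<open>\<psi>\<^sub>0 = 0\<close>.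
\<close>

theorem almansi_unique:
  assumes "\<And>j. j < k \<Longrightarrow> monogenic_on \<Omega> (\<psi> j)"
    and "\<And>x. x \<in> \<Omega> \<Longrightarrow> (\<Sum>j<k. cvec x ^ j * \<psi> j x) = 0"
  shows "j < k \<Longrightarrow> x \<in> \<Omega> \<Longrightarrow> \<psi> j x = 0"
  using assms
proof (induction k arbitrary: \<psi> j x)
  case (Suc k)
  note mono = Suc.prems(3) and rel = Suc.prems(4)
  have C1: "Ck_on 1 \<Omega> (\<psi> j)" if "j < Suc k" for j
    by (rule monogenic_on_imp_Ck_on[OF mono[OF that]])
  define \<theta> where "\<theta> j = I_op (1 + real j) (\<psi> j)" for j
  have mono_\<theta>: "monogenic_on \<Omega> (\<theta> j)" if "j < Suc k" for j
    unfolding \<theta>_def using mono[OF that] by (intro monogenic_on_I_op) auto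
  have C1_\<theta>: "Ck_on 1 \<Omega> (\<theta> j)" if "j < Suc k" for j
    by (rule monogenic_on_imp_Ck_on[OF mono_\<theta>[OF that]])
  have euler_\<theta>: "euler (\<theta> j) y + (1 + real j) *\<^sub>R \<theta> j y = \<psi> j y" if "j < Suc k" "y \<in> \<Omega>" for j y
    unfolding \<theta>_def using that by (intro euler_I_op C1) auto
  have rel_\<theta>: "(\<Sum>j<Suc k. cvec y ^ j * \<theta> j y) = 0" if y: "y \<in> \<Omega>" for y
  proof -
    have "(\<Sum>j<Suc k. cvec y ^ j * \<theta> j y) = (\<Sum>j<Suc k. I_op 1 (\<lambda>z. cvec z ^ j * \<psi> j z) y)"
      unfolding \<theta>_def
      by (intro sum.cong refl I_op_cvec_power_times[symmetric] y Ck_on_imp_continuous_on[OF C1]) auto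
    also have "\<dots> = I_op 1 (\<lambda>z. \<Sum>j<Suc k. cvec z ^ j * \<psi> j z) y"
      by (intro I_op_sum[symmetric] y Ck_on_imp_continuous_on[OF Ck_on_cvec_power_times[where k = 1]]
          open_dom C1) auto
    also have "\<dots> = 0"
      by (rule I_op_zero[OF rel y])
    finally show ?thesis .
  qed
  define \<omega> where "\<omega> j = dirac_step (Suc j) (\<theta> (Suc j))" for j
  have "monogenic_on \<Omega> (\<omega> j)" if j: "j < k" for j
  proof -
    \<comment> \<open>the coefficient of \<open>\<theta>\<^bsub>j+1\<^esub>\<close> after \<open>E \<theta>\<^bsub>j+1\<^esub>\<close> has been eliminated by \<open>euler_\<theta>\<close>\<close>
    let ?c = "if odd j then - real (Suc j)
      else 2 * (1 + real (Suc j)) - (real CARD('n) + 2 * real (Suc j div 2))"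
    have "monogenic_on \<Omega> (\<lambda>y. ?c *\<^sub>R \<theta> (Suc j) y + (if odd j then 0 else - 2) *\<^sub>R \<psi> (Suc j) y)"
      using j by (intro monogenic_on_add monogenic_on_scaleR open_dom mono mono_\<theta>) auto
    then show ?thesis
    proof (rule monogenic_on_cong[OF open_dom])
      fix y assume y: "y \<in> \<Omega>"
      have "Suc j < Suc k" using j by simp
      from euler_\<theta>[OF this y, symmetric]
      show "?c *\<^sub>R \<theta> (Suc j) y + (if odd j then 0 else - 2) *\<^sub>R \<psi> (Suc j) y = \<omega> j y"
        by (simp add: \<omega>_def dirac_step_def algebra_simps)
    qed
  qed
  moreover have "(\<Sum>j<k. cvec y ^ j * \<omega> j y) = 0" if y: "y \<in> \<Omega>" for y
  proof -
    have d: "\<theta> j differentiable (at y)" if "j < Suc k" for j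
      by (rule monogenic_on_imp_differentiable[OF mono_\<theta>[OF that] y])
    have "0 = dirac (\<lambda>z. \<Sum>j<Suc k. cvec z ^ j * \<theta> j z) y"
      by (simp only: dirac_cong_open[OF open_dom y rel_\<theta>] dirac_zero)
    also have "\<dots> = (\<Sum>j<Suc k. dirac (\<lambda>z. cvec z ^ j * \<theta> j z) y)"
      by (intro dirac_sum) (auto intro!: differentiable_cvec_power_times d)
    also have "\<dots> = (\<Sum>j<Suc k. cvec y ^ (j - 1) * dirac_step j (\<theta> j) y)"
      by (intro sum.cong refl dirac_cvec_power_times d monogenic_on_imp_dirac[OF mono_\<theta> y]) auto
    also have "\<dots> = (\<Sum>j<k. cvec y ^ j * \<omega> j y)"
      by (simp add: sum.lessThan_Suc_shift \<omega>_def dirac_step_def del: sum.lessThan_Suc)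
    finally show ?thesis by simp
  qed
  ultimately have \<omega>: "\<omega> j y = 0" if "j < k" "y \<in> \<Omega>" for j y
    using Suc.IH[of j y \<omega>] that by blast
  have pos: "\<psi> (Suc j) y = 0" if j: "j < k" and y: "y \<in> \<Omega>" for j y
  proof -
    have j': "Suc j < Suc k" using j by simp
    have 0: "\<theta> (Suc j) z = 0" if "z \<in> \<Omega>" for z
      by (rule zero_if_dirac_step_zero[OF C1_\<theta>[OF j'], of "Suc j"])
        (use \<omega>[OF j] that in \<open>auto simp: \<omega>_def\<close>)
    then have "euler (\<theta> (Suc j)) y = 0"
      by (simp only: euler_cong_open[OF open_dom y 0] euler_zero)
    then show ?thesis using euler_\<theta>[OF j' y] 0[OF y] by simp
  qed
  have "\<psi> 0 x = 0"
    using rel[OF Suc.prems(2)] pos[OF _ Suc.prems(2)]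
    by (simp add: sum.lessThan_Suc_shift del: sum.lessThan_Suc)
  then show ?case
    using pos Suc.prems(1,2) by (cases j) auto
qed simp

end


section \<open>Removing the shift by an exponential factor\<close>

lemma dirac_exp_times:
  fixes f :: "'n::{finite,linorder} cfield"
  assumes "f differentiable (at x)"
  shows "dirac (\<lambda>y. exp (- (\<alpha> \<bullet> y)) *\<^sub>R f y) x = exp (- (\<alpha> \<bullet> x)) *\<^sub>R dirac_shift \<alpha> f x"
proof -
  have "partial j (\<lambda>y. exp (- \<alpha> \<bullet> y) *\<^sub>R f y) x = exp (- \<alpha> \<bullet> x) *\<^sub>R (partial j f x - (\<alpha> $ j) *\<^sub>R f x)" for j
    by (simp add: partial_bounded_bilinear[OF bounded_bilinear_scaleR differentiable_exp_inner assms]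
        partial_exp_inner scaleR_diff_right mult.commute del: inner_minus_left)
  then show ?thesis
    by (simp add: dirac_def dirac_shift_def scaleR_sum_right)
qed

lemma Ck_on_dirac_shift:
  assumes "open S" "Ck_on (Suc k) S f"
  shows "Ck_on k S (dirac_shift \<alpha> f)"
  unfolding dirac_shift_def[abs_def]
  using assms(2) Ck_on_Suc_imp_Ck_on[OF assms(2)]
  by (intro Ck_on_sum[OF assms(1)] Ck_on_bounded_linear[OF assms(1) bounded_linear_clifford_times_left]
      Ck_on_diff[OF assms(1)] Ck_on_scaleR[OF assms(1)]) auto

lemma Ck_on_dirac_shift_funpow:
  assumes "open S" "Ck_on k S f"
  shows "i \<le> k \<Longrightarrow> Ck_on (k - i) S ((dirac_shift \<alpha> ^^ i) f)"
proof (induction i)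
  case (Suc i)
  then have "Ck_on (Suc (k - Suc i)) S ((dirac_shift \<alpha> ^^ i) f)"
    by (simp only: Suc_diff_Suc Suc_le_eq)
  then show ?case using Ck_on_dirac_shift[OF assms(1)] by simp
qed (simp add: assms)

context star_domain
begin

text \<open>
  The intertwining relation \<open>D (exp (- \<alpha> \<bullet> x) f) = exp (- \<alpha> \<bullet> x) (D - \<alpha>) f\<close>, iterated as long as the
  iterates stay differentiable.
\<close>

lemma dirac_funpow_exp_times:
  assumes "Ck_on k \<Omega> f"
  shows "i \<le> k \<Longrightarrow> x \<in> \<Omega> \<Longrightarrow> (dirac ^^ i) (\<lambda>y. exp (- (\<alpha> \<bullet> y)) *\<^sub>R f y) x
    = exp (- (\<alpha> \<bullet> x)) *\<^sub>R (dirac_shift \<alpha> ^^ i) f x"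
proof (induction i arbitrary: x)
  case (Suc i)
  have "Ck_on 1 \<Omega> ((dirac_shift \<alpha> ^^ i) f)"
    by (rule Ck_on_mono[OF Ck_on_dirac_shift_funpow[OF open_dom assms]]) (use Suc.prems in simp_all)
  then have d: "(dirac_shift \<alpha> ^^ i) f differentiable (at x)"
    using Suc.prems by simp
  have "(dirac ^^ Suc i) (\<lambda>y. exp (- (\<alpha> \<bullet> y)) *\<^sub>R f y) x
      = dirac (\<lambda>y. exp (- (\<alpha> \<bullet> y)) *\<^sub>R (dirac_shift \<alpha> ^^ i) f y) x"
    unfolding funpow.simps(2) o_apply
    by (rule dirac_cong_open[OF open_dom Suc.prems(2)]) (rule Suc.IH; use Suc.prems in simp)
  then show ?case
    by (simp add: dirac_exp_times[OF d])
qed simp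

lemma polymonogenic_exp_times:
  assumes "Ck_on k \<Omega> f" "\<forall>x\<in>\<Omega>. (dirac_shift \<alpha> ^^ k) f x = 0"
  shows "polymonogenic k (\<lambda>y. exp (- (\<alpha> \<bullet> y)) *\<^sub>R f y)"
  unfolding polymonogenic_def
proof (intro conjI allI ballI impI)
  fix i assume i: "i < k"
  have "Ck_on 1 \<Omega> ((dirac_shift \<alpha> ^^ i) f)"
    by (rule Ck_on_mono[OF Ck_on_dirac_shift_funpow[OF open_dom assms(1)]]) (use i in simp_all)
  from Ck_on_bounded_bilinear[OF open_dom bounded_bilinear_scaleR
      Ck_on_exp_inner[OF open_dom, of _ "- \<alpha>"] this]
  show "Ck_on 1 \<Omega> ((dirac ^^ i) (\<lambda>y. exp (- (\<alpha> \<bullet> y)) *\<^sub>R f y))"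
    by (rule Ck_on_cong[OF open_dom]) (use dirac_funpow_exp_times[OF assms(1)] i in simp)
next
  fix x assume "x \<in> \<Omega>"
  then show "(dirac ^^ k) (\<lambda>y. exp (- (\<alpha> \<bullet> y)) *\<^sub>R f y) x = 0"
    using dirac_funpow_exp_times[OF assms(1) order_refl] assms(2) by simp
qed

end

theorem lemma3p2:
  fixes \<Omega> :: "(real ^ 'n::{finite,linorder}) set"
    and k :: nat
    and \<alpha> :: "(real, 'n) vec"
    and \<phi> :: "'n cfield"
  assumes "open \<Omega>" and "connected \<Omega>" and "\<Omega> \<noteq> {}" and "star_like_0 \<Omega>"
    and "k \<ge> 1"
    and "Ck_on k \<Omega> \<phi>"
    and "\<forall>x\<in>\<Omega>. (dirac_shift \<alpha> ^^ k) \<phi> x = 0"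
  shows "\<exists>\<phi>s :: nat \<Rightarrow> 'n cfield.
    (\<forall>x\<in>\<Omega>. \<phi> x = exp (\<alpha> \<bullet> x) *\<^sub>R (\<Sum>j<k. cvec x ^ j * \<phi>s j x)) \<and>
    (\<forall>j<k. monogenic_on \<Omega> (\<phi>s j)) \<and>
    (\<forall>j<k. \<forall>x\<in>\<Omega>. \<phi>s j x = almansi_component k j (\<lambda>y. exp (- (\<alpha> \<bullet> y)) *\<^sub>R \<phi> y) x) \<and>
    (\<forall>\<psi> :: nat \<Rightarrow> 'n cfield.
      (\<forall>x\<in>\<Omega>. \<phi> x = exp (\<alpha> \<bullet> x) *\<^sub>R (\<Sum>j<k. cvec x ^ j * \<psi> j x)) \<and>
      (\<forall>j<k. monogenic_on \<Omega> (\<psi> j)) \<longrightarrow>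
      (\<forall>j<k. \<forall>x\<in>\<Omega>. \<psi> j x = \<phi>s j x))"
proof -
  interpret star_domain \<Omega>
    using assms by unfold_locales
  define \<phi>s where "\<phi>s j = almansi_component k j (\<lambda>y. exp (- (\<alpha> \<bullet> y)) *\<^sub>R \<phi> y)" for j
  have mono: "\<forall>j<k. monogenic_on \<Omega> (\<phi>s j)"
    and sum: "\<forall>x\<in>\<Omega>. exp (- (\<alpha> \<bullet> x)) *\<^sub>R \<phi> x = (\<Sum>j<k. cvec x ^ j * \<phi>s j x)"
    using almansi_decomposition[OF polymonogenic_exp_times[OF assms(6,7)]] unfolding \<phi>s_def by auto
  have exp_iff: "\<phi> x = exp (\<alpha> \<bullet> x) *\<^sub>R v \<longleftrightarrow> exp (- (\<alpha> \<bullet> x)) *\<^sub>R \<phi> x = v" for x v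
    by (auto simp: exp_minus)
  have "\<psi> j x = \<phi>s j x"
    if \<psi>: "\<forall>x\<in>\<Omega>. exp (- (\<alpha> \<bullet> x)) *\<^sub>R \<phi> x = (\<Sum>j<k. cvec x ^ j * \<psi> j x)"
      "\<forall>j<k. monogenic_on \<Omega> (\<psi> j)" and j: "j < k" and x: "x \<in> \<Omega>" for \<psi> :: "nat \<Rightarrow> 'n cfield" and j x
  proof -
    have "(\<lambda>x. \<psi> j x - \<phi>s j x) x = 0"
    proof (rule almansi_unique[OF _ _ j x])
      show "monogenic_on \<Omega> (\<lambda>x. \<psi> i x - \<phi>s i x)" if "i < k" for i
        using mono \<psi>(2) that by (intro monogenic_on_diff open_dom) auto
      show "(\<Sum>i<k. cvec y ^ i * (\<psi> i y - \<phi>s i y)) = 0" if "y \<in> \<Omega>" for y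
        using sum \<psi>(1) that by (simp add: right_diff_distrib sum_subtractf)
    qed
    then show ?thesis by simp
  qed
  then show ?thesis
    using mono sum unfolding exp_iff by (intro exI[of _ \<phi>s]) (simp add: \<phi>s_def)
qed

end
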